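(* Let $\alpha\in(0,1)$, $E,A\in\mathbb{R}^{n\times n}$ with $\operatorname{rank}(E)=r<n$, $B\in\mathbb{R}^{n\times m}$, $C\in\mathbb{R}^{p\times n}$. Fix $E_1\in\mathbb{R}^{n\times(n-r)}$ with $\operatorname{rank}(E_1)=n-r$, $EE_1=0$, and $E_2\in\mathbb{R}^{(n-r)\times n}$ with $\operatorname{rank}(E_2)=n-r$, $E_2E=0$. Consider the system $E\mathscr{D}^\alpha x(t)=Ax(t)+Bu(t)$, $y(t)=Cx(t)$, with output feedback $u(t)=Fy(t)$, $F\in\mathbb{R}^{m\times p}$, so the closed-loop system is $E\mathscr{D}^\alpha x(t)=(A+BFC)x(t)$. Then this closed-loop system is admissible if and only if the following hold: there exist $X\in\mathbb{P}_\alpha^{n\times n}$, $Y\in\mathbb{R}^{(n-r)\times n}$, $Z\in\mathbb{R}^{m\times n}$ with $\mathrm{sym}(AXE^{\mathrm T}+AE_1Y+BZ)<0$, and, with $K_0=Z(XE^{\mathrm T}+E_1Y)^{-1}$, there exist $P\in\mathbb{P}_\alpha^{n\times n}$, $Q\in\mathbb{R}^{n\times(n-r)}$, $G\in\mathbb{R}^{m\times m}$, $H\in\mathbb{R}^{m\times p}$ such that $\begin{bmatrix}\Phi & (E^{\mathrm T}P+QE_2)B+C^{\mathrm T}H^{\mathrm T}-K_0^{\mathrm T}G^{\mathrm T}\\ * & -G-G^{\mathrm T}\end{bmatrix}<0$, where $\Phi=\mathrm{sym}\big(E^{\mathrm T}P(A+BK_0)+QE_2(A+BK_0)\big)$, and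 the controller gain is given by $F=G^{-1}H$.
   Context: $\mathscr{D}^\alpha$ denotes the Caputo fractional derivative of order $\alpha$. For a square matrix $M$, $\mathrm{sym}(M)=M^{\mathrm T}+M$; "$<0$" means negative definite; $*$ denotes the symmetric block, i.e. $\begin{bmatrix}A&B\\ *&C\end{bmatrix}=\begin{bmatrix}A&B\\ B^{\mathrm T}&C\end{bmatrix}$. For $\alpha\in(0,1)$, $\mathbb{P}_\alpha^{k\times k}=\{\sin(\tfrac{\alpha\pi}{2})X+\cos(\tfrac{\alpha\pi}{2})Y: X,Y\in\mathbb{R}^{k\times k},\ \begin{bmatrix}X&Y\\-Y&X\end{bmatrix}>0\}$ (positive definite). A system $\mathcal E\mathscr{D}^\alpha z=\mathcal A z$ is admissible if $\{\mathcal E,\mathcal A\}$ is regular ($\det(s\mathcal E-\mathcal A)\not\equiv0$), impulse free ($\deg\det(s\mathcal E-\mathcal A)=\operatorname{rank}\mathcal E$), and stable (all finite roots $\lambda$ of $\det(\lambda\mathcal E-\mathcal A)=0$ satisfy $|\arg\lambda|>\alpha\pi/2$). *)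

theory Defs
  imports "HOL-Analysis.Analysis" "HOL-Computational_Algebra.Polynomial"
begin

definition msym :: "real^'n^'n \<Rightarrow> real^'n^'n" where
  "msym M = transpose M + M"

definition neg_def :: "real^'n^'n \<Rightarrow> bool" where
  "neg_def M \<longleftrightarrow> transpose M = M \<and> (\<forall>x. x \<noteq> 0 \<longrightarrow> x \<bullet> (M *v x) < 0)"

definition pos_def :: "real^'n^'n \<Rightarrow> bool" where
  "pos_def M \<longleftrightarrow> transpose M = M \<and> (\<forall>x. x \<noteq> 0 \<longrightarrow> x \<bullet> (M *v x) > 0)"

definition block2 ::
  "'c^'a^'a \<Rightarrow> 'c^'b^'a \<Rightarrow> 'c^'a^'b \<Rightarrow> 'c^'b^'b \<Rightarrow> 'c^('a + 'b)^('a + 'b)" where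
  "block2 M11 M12 M21 M22 = (\<chi> i j. case i of
      Inl i1 \<Rightarrow> (case j of Inl j1 \<Rightarrow> M11 $ i1 $ j1 | Inr j2 \<Rightarrow> M12 $ i1 $ j2)
    | Inr i2 \<Rightarrow> (case j of Inl j1 \<Rightarrow> M21 $ i2 $ j1 | Inr j2 \<Rightarrow> M22 $ i2 $ j2))"

definition P_alpha :: "real \<Rightarrow> (real^'k^'k) set" where
  "P_alpha \<alpha> = {sin (\<alpha> * pi / 2) *\<^sub>R X + cos (\<alpha> * pi / 2) *\<^sub>R Y | X Y.
      pos_def (block2 X Y (- Y) X)}"

definition pencil_det :: "real^'n^'n \<Rightarrow> real^'n^'n \<Rightarrow> real poly" where
  "pencil_det E A = det (\<chi> i j. [: - (A $ i $ j), E $ i $ j :])"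

definition regular_pencil :: "real^'n^'n \<Rightarrow> real^'n^'n \<Rightarrow> bool" where
  "regular_pencil E A \<longleftrightarrow> pencil_det E A \<noteq> 0"

definition impulse_free :: "real^'n^'n \<Rightarrow> real^'n^'n \<Rightarrow> bool" where
  "impulse_free E A \<longleftrightarrow> degree (pencil_det E A) = rank E"

definition frac_stable :: "real \<Rightarrow> real^'n^'n \<Rightarrow> real^'n^'n \<Rightarrow> bool" where
  "frac_stable \<alpha> E A \<longleftrightarrow>
     (\<forall>z::complex. poly (map_poly complex_of_real (pencil_det E A)) z = 0 \<longrightarrow>
        \<bar>Arg z\<bar> > \<alpha> * pi / 2)"

definition admissible :: "real \<Rightarrow> real^'n^'n \<Rightarrow> real^'n^'n \<Rightarrow> bool" where
  "admissible \<alpha> E A \<longleftrightarrow> regular_pencil E A \<and> impulse_free E A \<and> frac_stable \<alpha> E A"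

end

theory Submission
  imports Defs "HOL-Computational_Algebra.Fundamental_Theorem_Algebra"
begin

text \<open>
  The heart of the matter is the equivalence of admissibility of \<open>(E, M)\<close> with solvability of
  \<open>sym (E\<^sup>T P M + Q E2 M) < 0\<close>, applied to \<open>M = A + B F C\<close> and to the transposed pencil.
  Given the inequality, a vector with \<open>E x = 0\<close> and \<open>E2 M x = 0\<close> must vanish, which is regularity
  and freedom from impulses, and an eigenvector for a root in the closed sector makes the quadratic
  form nonnegative. Conversely, if the inequality is not solvable, separating the cone of its left-hand
  sides from the negative definite matrices gives a nonzero positive semidefinite \<open>S\<close> with
  \<open>E2 M S = 0\<close> whose range is invariant under \<open>M\<^sup>-\<^sup>1 E\<close>; an eigenvector in the range of \<open>S\<close> is either
  an impulsive mode or belongs to a finite root inside the sector.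

  The gains are then handled by testing the block inequality on \<open>(x, (F C - K0) x)\<close> in one direction,
  and by \<open>K0 = F C\<close>, \<open>G = g I\<close> with \<open>g\<close> large in the other.
\<close>

subsection \<open>Quadratic forms of block matrices\<close>

text \<open>As simplification rules these turn \<open>transpose M *v x\<close> into a row-vector
  product, which would keep the adjoint identities below from applying.\<close>

declare transpose_matrix_vector [simp del] vector_transpose_matrix [simp del]

lemma matrix_vector_mult_uminus_left: "(- M) *v x = - (M *v x)" for M :: "real^'n^'m"
  by (simp add: matrix_vector_mult_def vec_eq_iff sum_negf)

lemma matrix_vector_mult_uminus_right: "M *v (- x) = - (M *v x)" for M :: "real^'n^'m"
  by (simp add: matrix_vector_mult_def vec_eq_iff sum_negf)

lemma matrix_vector_mult_scaleR_left: "(c *\<^sub>R M) *v x = c *\<^sub>R (M *v x)" for M :: "real^'n^'m"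
  by (simp add: matrix_vector_mult_def vec_eq_iff sum_distrib_left mult.assoc)

lemmas mv_simps = matrix_vector_mult_uminus_left matrix_vector_mult_uminus_right
  matrix_vector_mult_scaleR_left matrix_vector_mult_scaleR matrix_vector_right_distrib
  matrix_vector_mult_diff_distrib matrix_vector_mult_add_rdistrib matrix_vector_mult_diff_rdistrib
  matrix_vector_mul_assoc [symmetric]

lemma inner_transpose_left: "(transpose M *v x) \<bullet> y = x \<bullet> (M *v y)" for M :: "real^'n^'m"
  by (simp add: transpose_matrix_vector dot_lmul_matrix)

lemma inner_transpose_right: "x \<bullet> (transpose M *v y) = y \<bullet> (M *v x)" for M :: "real^'n^'m"
  by (metis inner_commute inner_transpose_left)

lemma transpose_add: "transpose (M + N) = transpose M + transpose N" for M N :: "real^'n^'m"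
  by (simp add: transpose_def vec_eq_iff)

lemma transpose_diff: "transpose (M - N) = transpose M - transpose N" for M N :: "real^'n^'m"
  by (simp add: transpose_def vec_eq_iff)

lemma transpose_uminus: "transpose (- M) = - transpose M" for M :: "real^'n^'m"
  by (simp add: transpose_def vec_eq_iff)

text \<open>\<open>M\<close> and its transpose have the same quadratic form, so symmetrising only
  doubles it. From here on matrix inequalities are sign conditions on forms of nonsymmetric
  matrices.\<close>

lemma neg_def_msym_iff: "neg_def (msym M) \<longleftrightarrow> (\<forall>x. x \<noteq> 0 \<longrightarrow> x \<bullet> (M *v x) < 0)"
  by (auto simp: neg_def_def msym_def transpose_add mv_simps inner_add_right inner_transpose_right
      add.commute)

lemma neg_form_imp_invertible:
  fixes M :: "real^'n^'n"
  assumes "\<And>x. x \<noteq> 0 \<Longrightarrow> x \<bullet> (M *v x) < 0"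
  shows "invertible M"
proof -
  have "\<forall>x. M *v x = 0 \<longrightarrow> x = 0"
    using assms by fastforce
  then show ?thesis
    by (metis invertible_left_inverse matrix_left_invertible_ker)
qed

definition vjoin :: "real^'a \<Rightarrow> real^'b \<Rightarrow> real^('a + 'b)" where
  "vjoin x y = (\<chi> i. case i of Inl a \<Rightarrow> x $ a | Inr b \<Rightarrow> y $ b)"

lemma vjoin_surj: "\<exists>x y. z = vjoin x y"
  by (rule exI [of _ "\<chi> a. z $ Inl a"], rule exI [of _ "\<chi> b. z $ Inr b"])
    (auto simp: vjoin_def vec_eq_iff split: sum.splits)

lemma vjoin_eq_0_iff: "vjoin x y = 0 \<longleftrightarrow> x = 0 \<and> y = 0"
  by (auto simp: vjoin_def vec_eq_iff split: sum.splits)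

lemma sum_UNIV_Plus:
  fixes f :: "'a::finite + 'b::finite \<Rightarrow> 'c::comm_monoid_add"
  shows "(\<Sum>i\<in>UNIV. f i) = (\<Sum>a\<in>UNIV. f (Inl a)) + (\<Sum>b\<in>UNIV. f (Inr b))"
  by (subst UNIV_Plus_UNIV [symmetric]) (simp add: sum.Plus del: UNIV_Plus_UNIV)

lemma inner_vjoin: "vjoin x y \<bullet> vjoin x' y' = x \<bullet> x' + y \<bullet> y'"
  by (simp add: inner_vec_def sum_UNIV_Plus vjoin_def)

lemma block2_vjoin:
  "block2 M11 M12 M21 M22 *v vjoin x y = vjoin (M11 *v x + M12 *v y) (M21 *v x + M22 *v y)"
  by (auto simp: vec_eq_iff matrix_vector_mult_def sum_UNIV_Plus vjoin_def block2_def
      split: sum.splits)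

lemma transpose_block2:
  "transpose (block2 M11 M12 M21 M22)
    = block2 (transpose M11) (transpose M21) (transpose M12) (transpose M22)"
  by (auto simp: vec_eq_iff transpose_def block2_def split: sum.splits)

lemma all_sum_iff: "(\<forall>i. P i) \<longleftrightarrow> (\<forall>a. P (Inl a)) \<and> (\<forall>b. P (Inr b))"
  by (metis sum.exhaust)

lemma block2_eq_iff:
  "block2 M11 M12 M21 M22 = block2 N11 N12 N21 N22
    \<longleftrightarrow> M11 = N11 \<and> M12 = N12 \<and> M21 = N21 \<and> M22 = N22"
  by (auto simp: vec_eq_iff block2_def all_sum_iff)

lemma neg_def_block2_iff:
  "neg_def (block2 M11 M12 (transpose M12) M22) \<longleftrightarrow>
    transpose M11 = M11 \<and> transpose M22 = M22 \<and>
    (\<forall>x y. x \<noteq> 0 \<or> y \<noteq> 0 \<longrightarrow> x \<bullet> (M11 *v x) + 2 * (x \<bullet> (M12 *v y)) + y \<bullet> (M22 *v y) < 0)"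
proof -
  have *: "vjoin x y \<bullet> (block2 M11 M12 (transpose M12) M22 *v vjoin x y)
      = x \<bullet> (M11 *v x) + 2 * (x \<bullet> (M12 *v y)) + y \<bullet> (M22 *v y)" for x y
    by (simp add: block2_vjoin inner_vjoin inner_add_right inner_transpose_right)
  have "(\<forall>z. z \<noteq> 0 \<longrightarrow> z \<bullet> (block2 M11 M12 (transpose M12) M22 *v z) < 0) \<longleftrightarrow>
    (\<forall>x y. x \<noteq> 0 \<or> y \<noteq> 0 \<longrightarrow> x \<bullet> (M11 *v x) + 2 * (x \<bullet> (M12 *v y)) + y \<bullet> (M22 *v y) < 0)"
    by (metis * vjoin_eq_0_iff vjoin_surj)
  then show ?thesis
    by (auto simp: neg_def_def transpose_block2 block2_eq_iff)
qed

text \<open>Symmetry of the block matrix forces \<open>X\<close> symmetric and \<open>Y\<close>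
  skew; the form is then that of the Hermitian matrix X - i Y at the complex vector x + i y.\<close>

lemma P_alpha_iff:
  "P \<in> P_alpha \<alpha> \<longleftrightarrow> (\<exists>X Y. P = sin (\<alpha> * pi / 2) *\<^sub>R X + cos (\<alpha> * pi / 2) *\<^sub>R Y \<and>
    transpose X = X \<and> transpose Y = - Y \<and>
    (\<forall>x y. x \<noteq> 0 \<or> y \<noteq> 0 \<longrightarrow> x \<bullet> (X *v x) + y \<bullet> (X *v y) + 2 * (x \<bullet> (Y *v y)) > 0))"
proof -
  have "pos_def (block2 X Y (- Y) X) \<longleftrightarrow> transpose X = X \<and> transpose Y = - Y \<and>
    (\<forall>x y. x \<noteq> 0 \<or> y \<noteq> 0 \<longrightarrow> x \<bullet> (X *v x) + y \<bullet> (X *v y) + 2 * (x \<bullet> (Y *v y)) > 0)"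
    for X Y :: "real^'a^'a"
  proof (cases "transpose X = X \<and> transpose Y = - Y")
    case True
    have "y \<bullet> ((- Y) *v x) = x \<bullet> (Y *v y)" for x y
      by (metis True inner_transpose_right)
    then have *: "vjoin x y \<bullet> (block2 X Y (- Y) X *v vjoin x y)
        = x \<bullet> (X *v x) + y \<bullet> (X *v y) + 2 * (x \<bullet> (Y *v y))" for x y
      by (simp add: block2_vjoin inner_vjoin inner_add_right)
    have "(\<forall>z. z \<noteq> 0 \<longrightarrow> z \<bullet> (block2 X Y (- Y) X *v z) > 0) \<longleftrightarrow>
      (\<forall>x y. x \<noteq> 0 \<or> y \<noteq> 0 \<longrightarrow> x \<bullet> (X *v x) + y \<bullet> (X *v y) + 2 * (x \<bullet> (Y *v y)) > 0)"
      by (metis * vjoin_eq_0_iff vjoin_surj)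
    with True show ?thesis
      by (simp add: pos_def_def transpose_block2 block2_eq_iff transpose_uminus)
  next
    case False
    then show ?thesis
      by (auto simp: pos_def_def transpose_block2 block2_eq_iff transpose_uminus)
  qed
  then show ?thesis
    by (auto simp: P_alpha_def)
qed

text \<open>Transposing replaces \<open>Y\<close> by \<open>- Y\<close>, that is, conjugates the
  Hermitian matrix; positivity at (x, y) is the old positivity at (x, - y).\<close>

lemma transpose_in_P_alpha:
  assumes "P \<in> P_alpha \<alpha>"
  shows "transpose P \<in> P_alpha \<alpha>"
proof -
  obtain X Y where P: "P = sin (\<alpha> * pi / 2) *\<^sub>R X + cos (\<alpha> * pi / 2) *\<^sub>R Y"
    and X: "transpose X = X" and Y: "transpose Y = - Y"
    and pos: "\<And>x y. x \<noteq> 0 \<or> y \<noteq> 0 \<Longrightarrow> x \<bullet> (X *v x) + y \<bullet> (X *v y) + 2 * (x \<bullet> (Y *v y)) > 0"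
    using assms unfolding P_alpha_iff by blast
  have "transpose P = sin (\<alpha> * pi / 2) *\<^sub>R X + cos (\<alpha> * pi / 2) *\<^sub>R (- Y)"
    by (simp add: P transpose_add transpose_scalar X Y)
  moreover have "x \<bullet> (X *v x) + y \<bullet> (X *v y) + 2 * (x \<bullet> (- Y *v y)) > 0" if "x \<noteq> 0 \<or> y \<noteq> 0" for x y
    using pos [of x "- y"] that by (simp add: mv_simps)
  ultimately show ?thesis
    unfolding P_alpha_iff using X Y transpose_uminus by metis
qed

text \<open>By homogeneity it suffices to treat the unit sphere. Its part \<open>D\<close> with f
  \<ge> 0 is compact, so there f is bounded above and g is bounded away from 0.\<close>

lemma finsler_homogeneous:
  fixes f g :: "'a::euclidean_space \<Rightarrow> real"
  assumes "continuous_on UNIV f" "continuous_on UNIV g"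
    and f2: "\<And>c x. f (c *\<^sub>R x) = c\<^sup>2 * f x" and g2: "\<And>c x. g (c *\<^sub>R x) = c\<^sup>2 * g x"
    and g0: "\<And>x. g x \<ge> 0"
    and fg: "\<And>x. x \<noteq> 0 \<Longrightarrow> g x = 0 \<Longrightarrow> f x < 0"
  obtains \<mu> where "\<mu> > 0" "\<And>x. x \<noteq> 0 \<Longrightarrow> f x - \<mu> * g x < 0"
proof -
  define D where "D = sphere 0 1 \<inter> {x. f x \<ge> 0}"
  have "closed {x. f x \<ge> 0}"
    using assms(1) by (intro closed_Collect_le) auto
  then have D: "compact D"
    unfolding D_def by (simp add: compact_Int_closed)
  have "\<exists>\<mu>>0. \<forall>x\<in>sphere 0 1. f x - \<mu> * g x < 0"
  proof (cases "D = {}")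
    case True
    have "f x - 1 * g x < 0" if "x \<in> sphere 0 1" for x
      using True that g0 [of x] by (fastforce simp: D_def)
    then show ?thesis
      using zero_less_one by blast
  next
    case False
    obtain a where a: "a \<in> D" "\<And>x. x \<in> D \<Longrightarrow> g a \<le> g x"
      using continuous_attains_inf [OF D False] continuous_on_subset [OF assms(2)] by blast
    obtain b where b: "b \<in> D" "\<And>x. x \<in> D \<Longrightarrow> f x \<le> f b"
      using continuous_attains_sup [OF D False] continuous_on_subset [OF assms(1)] by blast
    have "a \<noteq> 0" "f a \<ge> 0" "f b \<ge> 0"
      using a(1) b(1) by (auto simp: D_def)
    then have "g a > 0"
      using fg [of a] g0 [of a] by fastforce
    \<comment> \<open>On \<open>D\<close> this multiplier makes the subtracted term at least
      \<open>f b + 1\<close>, which exceeds \<open>f x\<close>; off \<open>D\<close> already f < 0.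
      The added 1 gives strictness and a positive multiplier.\<close>
    have "f x - (f b + 1) / g a * g x < 0" if "x \<in> sphere 0 1" for x
    proof (cases "x \<in> D")
      case True
      have "(f b + 1) / g a * g a \<le> (f b + 1) / g a * g x"
        using a(2) [OF True] \<open>f b \<ge> 0\<close> \<open>g a > 0\<close> by (intro mult_left_mono) auto
      then show ?thesis
        using b(2) [OF True] \<open>g a > 0\<close> by simp
    next
      case False
      have "(f b + 1) / g a * g x \<ge> 0"
        using \<open>f b \<ge> 0\<close> \<open>g a > 0\<close> g0 [of x] by auto
      then show ?thesis
        using False that by (auto simp: D_def)
    qed
    moreover have "(f b + 1) / g a > 0"
      using \<open>f b \<ge> 0\<close> \<open>g a > 0\<close> by simp
    ultimately show ?thesis by blast
  qed
  then obtain \<mu> where "\<mu> > 0" and \<mu>: "\<And>x. norm x = 1 \<Longrightarrow> f x - \<mu> * g x < 0"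
    by auto
  have "f x - \<mu> * g x < 0" if "x \<noteq> 0" for x
  proof -
    have x: "x = norm x *\<^sub>R sgn x"
      by (simp add: sgn_div_norm that)
    have "f x - \<mu> * g x = (norm x)\<^sup>2 * (f (sgn x) - \<mu> * g (sgn x))"
      using f2 [of "norm x" "sgn x"] g2 [of "norm x" "sgn x"]
      by (simp add: x [symmetric] algebra_simps)
    moreover have "f (sgn x) - \<mu> * g (sgn x) < 0"
      using \<mu> that by (simp add: norm_sgn)
    ultimately show ?thesis
      using that by (simp add: mult_less_0_iff)
  qed
  with \<open>\<mu> > 0\<close> show thesis
    using that by blast
qed

subsection \<open>Roots of the pencil and the sector\<close>

text \<open>With \<phi> the absolute argument, the inequality in polar form is sin (\<theta> -
  \<phi>) \<ge> 0, and \<theta> - \<phi> lies strictly between - pi and pi / 2. The convention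
  \<open>Arg 0 = 0\<close> puts the origin into the sector.\<close>

lemma abs_Arg_le_iff:
  assumes "0 < \<theta>" "\<theta> < pi / 2"
  shows "\<bar>Arg z\<bar> \<le> \<theta> \<longleftrightarrow> cos \<theta> * \<bar>Im z\<bar> \<le> sin \<theta> * Re z"
proof (cases "z = 0")
  case True
  with assms show ?thesis by (simp add: Arg_zero)
next
  case False
  define \<phi> where "\<phi> = \<bar>Arg z\<bar>"
  have \<phi>: "0 \<le> \<phi>" "\<phi> \<le> pi"
    using Arg_bounded [of z] by (auto simp: \<phi>_def)
  have z: "Re z = norm z * cos (Arg z)" "Im z = norm z * sin (Arg z)"
    using Arg_correct [OF False] by (metis Re_rcis cis_Arg False rcis_cmod_Arg)
      (metis Im_rcis rcis_cmod_Arg)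
  have "Re z = norm z * cos \<phi>"
    using z by (simp add: \<phi>_def)
  moreover have "\<bar>Im z\<bar> = norm z * sin \<phi>"
  proof -
    have "\<bar>sin (Arg z)\<bar> = \<bar>sin \<phi>\<bar>" by (auto simp: \<phi>_def abs_if)
    then show ?thesis using z sin_ge_zero [OF \<phi>] by (simp add: abs_mult)
  qed
  ultimately have "cos \<theta> * \<bar>Im z\<bar> \<le> sin \<theta> * Re z \<longleftrightarrow> norm z * (cos \<theta> * sin \<phi>) \<le> norm z * (sin \<theta> * cos \<phi>)"
    by (simp add: mult.left_commute)
  also have "\<dots> \<longleftrightarrow> sin (\<theta> - \<phi>) \<ge> 0"
    using False by (simp add: sin_diff mult_le_cancel_left)
  also have "\<dots> \<longleftrightarrow> \<phi> \<le> \<theta>"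
  proof
    assume "\<phi> \<le> \<theta>"
    then show "sin (\<theta> - \<phi>) \<ge> 0"
      using assms \<phi> by (intro sin_ge_zero) auto
  next
    assume *: "sin (\<theta> - \<phi>) \<ge> 0"
    show "\<phi> \<le> \<theta>"
    proof (rule ccontr)
      assume "\<not> \<phi> \<le> \<theta>"
      then have "sin (\<phi> - \<theta>) > 0"
        using assms \<phi> by (intro sin_gt_zero) auto
      then show False
        using * sin_minus [of "\<theta> - \<phi>"] by simp
    qed
  qed
  finally show ?thesis by (simp add: \<phi>_def)
qed

section \<open>Determinants of polynomial matrices and of the pencil\<close>

lemma poly_det: "poly (det M) x = det (\<chi> i j. poly (M $ i $ j) x)"
  for M :: "'a::comm_ring_1 poly^'n^'n"
proof -
  have "poly (of_int k) x = of_int k" for k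
    by (simp add: of_int_poly)
  then show ?thesis
    by (simp add: det_def poly_sum poly_prod)
qed

lemma map_poly_of_real_add:
  "map_poly of_real (p + q) = map_poly of_real p + (map_poly of_real q :: complex poly)"
  by (rule poly_eqI) (simp add: coeff_map_poly)

lemma map_poly_of_real_mult:
  "map_poly of_real (p * q) = map_poly of_real p * (map_poly of_real q :: complex poly)"
  by (rule poly_eqI) (simp add: coeff_map_poly coeff_mult)

lemma map_poly_of_real_sum:
  "map_poly of_real (\<Sum>x\<in>A. f x) = (\<Sum>x\<in>A. map_poly of_real (f x) :: complex poly)"
  by (induction A rule: infinite_finite_induct) (auto simp: map_poly_of_real_add)

lemma map_poly_of_real_prod:
  "map_poly of_real (\<Prod>x\<in>A. f x) = (\<Prod>x\<in>A. map_poly of_real (f x) :: complex poly)"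
  by (induction A rule: infinite_finite_induct) (auto simp: map_poly_of_real_mult)

lemma map_poly_of_real_of_int: "map_poly of_real (of_int k) = (of_int k :: complex poly)"
  by (simp add: of_int_poly map_poly_pCons)

lemma map_poly_of_real_det:
  "map_poly of_real (det M) = det (\<chi> i j. (map_poly of_real (M $ i $ j) :: complex poly))"
  by (simp add: det_def map_poly_of_real_sum map_poly_of_real_mult map_poly_of_real_prod
      map_poly_of_real_of_int)

lemma poly_pencil_det: "poly (pencil_det E A) s = det (s *\<^sub>R E - A)"
  unfolding pencil_det_def poly_det by (rule arg_cong [where f = det]) (simp add: vec_eq_iff)

lemma pencil_det_transpose: "pencil_det (transpose E) (transpose A) = pencil_det E A"
proof -
  have "(\<chi> i j. [:- (transpose A $ i $ j), transpose E $ i $ j:])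
      = transpose (\<chi> i j. [:- (A $ i $ j), E $ i $ j:])"
    by (simp add: transpose_def vec_eq_iff)
  then show ?thesis
    by (simp add: pencil_det_def)
qed

lemma admissible_transpose: "admissible \<alpha> (transpose E) (transpose A) \<longleftrightarrow> admissible \<alpha> E A"
  by (simp add: admissible_def regular_pencil_def impulse_free_def frac_stable_def
      pencil_det_transpose rank_transpose)

lemma det_eq_0_iff_kernel: "det M = 0 \<longleftrightarrow> (\<exists>x. x \<noteq> 0 \<and> M *v x = 0)"
  for M :: "'a::field^'n^'n"
  using invertible_det_nz [of M] invertible_left_inverse [of M] matrix_left_invertible_ker [of M]
  by metis

text \<open>Complex eigenvectors are kept as pairs of real vectors, because the quadratic forms are
  real and get evaluated on each part.\<close>

definition cvec :: "real^'n \<Rightarrow> real^'n \<Rightarrow> complex^'n" where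
  "cvec x y = (\<chi> i. Complex (x $ i) (y $ i))"

lemma cvec_surj: "\<exists>x y. z = cvec x y"
  by (rule exI [of _ "\<chi> i. Re (z $ i)"], rule exI [of _ "\<chi> i. Im (z $ i)"])
    (simp add: cvec_def vec_eq_iff)

lemma cvec_eq_iff: "cvec x y = cvec x' y' \<longleftrightarrow> x = x' \<and> y = y'"
  by (auto simp: cvec_def vec_eq_iff)

lemma cvec_eq_0_iff: "cvec x y = 0 \<longleftrightarrow> x = 0 \<and> y = 0"
  by (auto simp: cvec_def vec_eq_iff complex_eq_iff)

lemma map_matrix_cvec: "map_matrix of_real M *v cvec x y = cvec (M *v x) (M *v y)"
  by (simp add: cvec_def vec_eq_iff matrix_vector_mult_def complex_eq_iff)

lemma smult_cvec: "z *s cvec x y = cvec (Re z *\<^sub>R x - Im z *\<^sub>R y) (Im z *\<^sub>R x + Re z *\<^sub>R y)"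
  by (simp add: cvec_def vec_eq_iff complex_eq_iff)

text \<open>The two equations are the real and imaginary parts of A v = z E v with v = x + i y, a
  kernel vector of the singular complex matrix z E - A.\<close>

lemma pencil_root_iff:
  "poly (map_poly complex_of_real (pencil_det E A)) z = 0 \<longleftrightarrow>
    (\<exists>x y. (x \<noteq> 0 \<or> y \<noteq> 0) \<and>
      A *v x = Re z *\<^sub>R (E *v x) - Im z *\<^sub>R (E *v y) \<and>
      A *v y = Im z *\<^sub>R (E *v x) + Re z *\<^sub>R (E *v y))"
proof -
  define M where "M = (\<chi> i j. z * complex_of_real (E $ i $ j) - complex_of_real (A $ i $ j))"
  have M: "M *v v = z *s (map_matrix of_real E *v v) - map_matrix of_real A *v v" for v
    by (simp add: M_def vec_eq_iff matrix_vector_mult_def algebra_simps sum_subtractf sum_distrib_left)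
  have "poly (map_poly complex_of_real (pencil_det E A)) z = det M"
    unfolding pencil_det_def map_poly_of_real_det poly_det M_def
    by (rule arg_cong [where f = det]) (simp add: vec_eq_iff map_poly_pCons)
  then have "poly (map_poly complex_of_real (pencil_det E A)) z = 0
      \<longleftrightarrow> (\<exists>x y. cvec x y \<noteq> 0 \<and> M *v cvec x y = 0)"
    by (metis det_eq_0_iff_kernel cvec_surj)
  also have "\<dots> \<longleftrightarrow> (\<exists>x y. (x \<noteq> 0 \<or> y \<noteq> 0) \<and>
      A *v x = Re z *\<^sub>R (E *v x) - Im z *\<^sub>R (E *v y) \<and>
      A *v y = Im z *\<^sub>R (E *v x) + Re z *\<^sub>R (E *v y))"
    by (simp add: M map_matrix_cvec smult_cvec cvec_eq_0_iff cvec_eq_iff)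
      (metis (no_types, lifting))
  finally show ?thesis .
qed

subsection \<open>Regularity and freedom from impulses\<close>

text \<open>Multiplying by s^m with m the degree of q clears the negative powers and gives k s^m p =
  s^r \<open>reflect_poly q\<close>, first at infinitely many points and hence as polynomials.
  Comparing degrees, p has degree r exactly if the reflected polynomial keeps degree m, which means
  that q does not vanish at 0.\<close>

lemma degree_eq_iff_reversed:
  fixes p q :: "real poly"
  assumes "k \<noteq> 0" and pq: "\<And>s. s \<noteq> 0 \<Longrightarrow> k * poly p s = s ^ r * poly q (inverse s)"
  shows "p \<noteq> 0 \<and> degree p = r \<longleftrightarrow> poly q 0 \<noteq> 0"
proof -
  define m where "m = degree q"
  have "poly (monom 1 m * smult k p) s = poly (monom 1 r * reflect_poly q) s" if "s \<noteq> 0" for s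
    using pq [OF that] by (simp add: poly_monom poly_reflect_poly_nz that m_def)
  then have "{s. poly (monom 1 m * smult k p - monom 1 r * reflect_poly q) s \<noteq> 0} \<subseteq> {0}"
    by auto
  then have "infinite {s. poly (monom 1 m * smult k p - monom 1 r * reflect_poly q) s = 0}"
  proof -
    have "- {0::real} \<subseteq> {s. poly (monom 1 m * smult k p - monom 1 r * reflect_poly q) s = 0}"
      using \<open>_ \<subseteq> {0}\<close> by blast
    moreover have "infinite (- {0::real})"
      by (simp add: infinite_UNIV_char_0 Compl_eq_Diff_UNIV)
    ultimately show ?thesis
      using finite_subset by blast
  qed
  then have eq: "monom 1 m * smult k p = monom 1 r * reflect_poly q"
    using poly_roots_finite [of "monom 1 m * smult k p - monom 1 r * reflect_poly q"] by auto
  have p0: "p = 0 \<longleftrightarrow> q = 0"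
    using arg_cong [OF eq, of "\<lambda>u. u = 0"] \<open>k \<noteq> 0\<close> by (simp add: monom_eq_0_iff)
  have deg: "m + degree p = r + degree (reflect_poly q)" if "p \<noteq> 0"
  proof -
    have "degree (monom 1 m * smult k p) = m + degree p"
      using that \<open>k \<noteq> 0\<close> by (subst degree_mult_eq) (auto simp: degree_monom_eq)
    moreover have "degree (monom 1 r * reflect_poly q) = r + degree (reflect_poly q)"
      using that p0 by (subst degree_mult_eq) (auto simp: degree_monom_eq)
    ultimately show ?thesis
      by (metis eq)
  qed
  show ?thesis
  proof
    assume p: "p \<noteq> 0 \<and> degree p = r"
    then have "degree (reflect_poly q) = m"
      using deg by simp
    then have "coeff (reflect_poly q) m \<noteq> 0"
      using p p0 by (metis leading_coeff_0_iff reflect_poly_eq_0_iff)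
    then show "poly q 0 \<noteq> 0"
      by (simp add: coeff_reflect_poly m_def poly_0_coeff_0)
  next
    assume q: "poly q 0 \<noteq> 0"
    then have "degree (reflect_poly q) = m"
      by (simp add: m_def poly_0_coeff_0)
    then show "p \<noteq> 0 \<and> degree p = r"
      using q p0 deg by auto
  qed
qed

lemma eq_zero_if_orthogonal_spanning:
  fixes v :: "'a::euclidean_space"
  assumes "x \<in> span S" "\<And>b. b \<in> S \<Longrightarrow> b \<bullet> v = 0"
  shows "x \<bullet> v = 0"
  using orthogonal_to_span [OF assms(1), of v] assms(2) by (simp add: orthogonal_def inner_commute)

text \<open>
  A row transformation \<open>L\<close> whose rows include a basis of the row space of \<open>N\<close> annihilates the rows of
  \<open>E\<close> outside an index set \<open>J\<close> of size \<open>rank E\<close>. Pulling \<open>s\<close> out of the rows in \<open>J\<close> shows that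
  \<open>det L * det (s E - A)\<close> is \<open>s ^ rank E\<close> times a polynomial \<open>q\<close> in \<open>1 / s\<close>.
\<close>
lemma regular_impulse_free_iff:
  fixes E A :: "real^'n^'n" and N :: "real^'n^'k"
  assumes rankN: "rank N = CARD('k)" and NE: "N ** E = 0"
    and card: "CARD('k) = CARD('n) - rank E"
  shows "regular_pencil E A \<and> impulse_free E A \<longleftrightarrow>
    (\<forall>x. E *v x = 0 \<longrightarrow> N *v (A *v x) = 0 \<longrightarrow> x = 0)"
proof -
  obtain B0 where B0: "B0 \<subseteq> rows N" "independent B0" "rows N \<subseteq> span B0" "card B0 = dim (rows N)"
    using basis_exists [of "rows N"] by blast
  obtain B where B: "B0 \<subseteq> B" "independent B" "UNIV \<subseteq> span B"
    using maximal_independent_subset_extend [OF subset_UNIV B0(2)] by metis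
  have finB: "finite B"
    using B(2) independent_bound by blast
  have "card B = CARD('n)"
    using basis_card_eq_dim [of B UNIV] B by (simp add: dim_UNIV)
  then obtain f where f: "bij_betw f (UNIV :: 'n set) B"
    using finite_same_card_bij finB finite_class.finite_UNIV by metis
  \<comment> \<open>The rows of \<open>L\<close> outside \<open>J\<close> form the basis
    \<open>B0\<close> of the row space of \<open>N\<close>; there are \<open>CARD('k)\<close> of
    them, which leaves \<open>rank E\<close> indices in \<open>J\<close>.\<close>
  define J where "J = {i. f i \<notin> B0}"
  have "f ` (- J) = B0"
    using f B(1) by (fastforce simp: J_def bij_betw_def)
  moreover have "inj_on f (- J)"
    using f by (metis bij_betw_def inj_on_subset subset_UNIV)
  moreover have "card (f ` (- J)) = card (- J)"
    by (rule card_image) fact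
  ultimately have "card (- J) = CARD('k)"
    using B0(4) rankN by (simp add: row_rank_def)
  moreover have "rank E \<le> CARD('n)"
    using rank_bound [of E] by simp
  moreover have "card J + card (- J) = CARD('n)"
    using card_Un_disjoint [of J "- J"] by simp
  ultimately have cardJ: "card J = rank E"
    using card by simp
  define L :: "real^'n^'n" where "L = (\<chi> i. f i)"
  have Lv: "(L *v v) $ i = f i \<bullet> v" for v i
    by (simp add: matrix_vector_mul_component L_def)
  have L0: "v = 0" if "L *v v = 0" for v
  proof -
    have "b \<bullet> v = 0" if "b \<in> B" for b
      using \<open>L *v v = 0\<close> that f Lv by (metis bij_betw_def imageE zero_index)
    then have "v \<bullet> v = 0"
      using eq_zero_if_orthogonal_spanning [of v B v] B(3) by blast
    then show ?thesis by simp
  qed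
  then have detL: "det L \<noteq> 0"
    using det_eq_0_iff_kernel by blast
  have N0: "N *v v = 0 \<longleftrightarrow> (\<forall>i. i \<notin> J \<longrightarrow> (L *v v) $ i = 0)" for v
  proof -
    have "N *v v = 0 \<longleftrightarrow> (\<forall>b\<in>rows N. b \<bullet> v = 0)"
    proof -
      have "rows N = range (($) N)"
        by (auto simp: rows_def row_def)
      then show ?thesis
        by (simp add: vec_eq_iff matrix_vector_mul_component)
    qed
    also have "\<dots> \<longleftrightarrow> (\<forall>b\<in>B0. b \<bullet> v = 0)"
      using B0(1,3) eq_zero_if_orthogonal_spanning by blast
    also have "\<dots> \<longleftrightarrow> (\<forall>i. i \<notin> J \<longrightarrow> (L *v v) $ i = 0)"
      using \<open>f ` (- J) = B0\<close> by (auto simp: Lv)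
    finally show ?thesis .
  qed
  have LE0: "(L *v (E *v v)) $ i = 0" if "i \<notin> J" for v i
    using N0 [of "E *v v"] NE that by (simp add: matrix_vector_mul_assoc)
  have LE0': "(L ** E) $ i $ j = 0" if "i \<notin> J" for i j
  proof -
    have "(L ** E) *v axis j 1 = column j (L ** E)"
      by (simp add: matrix_vector_mult_basis)
    then show ?thesis
      using LE0 [OF that, of "axis j 1"] by (simp add: matrix_vector_mul_assoc column_def)
  qed
  \<comment> \<open>This is what remains of L (s E - A) when s is taken out of the rows in
    \<open>J\<close>, with t = 1 / s; in the other rows L E vanishes. At t = 0 it describes the
    behaviour as s tends to infinity, which governs the degree.\<close>
  define M where "M t = (\<chi> i j. if i \<in> J then (L ** E) $ i $ j - t * (L ** A) $ i $ j else - (L ** A) $ i $ j)"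
    for t :: real
  define q where "q = det (\<chi> i j. if i \<in> J then [:(L ** E) $ i $ j, - (L ** A) $ i $ j:] else [:- (L ** A) $ i $ j:])"
  have q: "poly q t = det (M t)" for t
    unfolding q_def poly_det M_def by (rule arg_cong [where f = det]) (simp add: vec_eq_iff)
  have "det L * poly (pencil_det E A) s = s ^ rank E * poly q (inverse s)" if "s \<noteq> 0" for s
  proof -
    have "det L * poly (pencil_det E A) s = det (L ** (s *\<^sub>R E - A))"
      by (simp add: poly_pencil_det det_mul)
    also have "L ** (s *\<^sub>R E - A) = s *\<^sub>R (L ** E) - L ** A"
      by (simp add: matrix_eq mv_simps)
    also have "\<dots> = (\<chi> i. (if i \<in> J then s else 1) *s M (inverse s) $ i)"
      using that LE0' by (auto simp: vec_eq_iff M_def field_simps)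
    also have "det \<dots> = (\<Prod>i\<in>UNIV. if i \<in> J then s else 1) * det (M (inverse s))"
      by (subst det_rows_mul) simp
    also have "(\<Prod>i\<in>UNIV. if i \<in> J then s else 1) = s ^ rank E"
      by (simp add: prod.If_cases cardJ)
    finally show ?thesis by (simp add: q)
  qed
  then have "regular_pencil E A \<and> impulse_free E A \<longleftrightarrow> det (M 0) \<noteq> 0"
    unfolding regular_pencil_def impulse_free_def q [symmetric]
    by (intro degree_eq_iff_reversed [OF detL]) auto
  also have "\<dots> \<longleftrightarrow> (\<forall>x. M 0 *v x = 0 \<longrightarrow> x = 0)"
    using det_eq_0_iff_kernel by blast
  finally have *: "regular_pencil E A \<and> impulse_free E A \<longleftrightarrow> (\<forall>x. M 0 *v x = 0 \<longrightarrow> x = 0)" .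
  \<comment> \<open>\<open>M 0\<close> has the rows of L E in \<open>J\<close> and those of - L A
    elsewhere, so its kernel is the common kernel of \<open>E\<close> and
    \<open>N ** A\<close>.\<close>
  have "M 0 *v x = 0 \<longleftrightarrow> E *v x = 0 \<and> N *v (A *v x) = 0" for x
  proof -
    have "(M 0 *v x) $ i = (if i \<in> J then (L *v (E *v x)) $ i else - (L *v (A *v x)) $ i)" for i
      unfolding matrix_vector_mul_assoc by (simp add: matrix_vector_mult_def M_def sum_negf)
    then have "M 0 *v x = 0 \<longleftrightarrow> (\<forall>i\<in>J. (L *v (E *v x)) $ i = 0) \<and> N *v (A *v x) = 0"
      unfolding N0 by (simp add: vec_eq_iff) blast
    also have "(\<forall>i\<in>J. (L *v (E *v x)) $ i = 0) \<longleftrightarrow> L *v (E *v x) = 0"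
      using LE0 by (auto simp: vec_eq_iff)
    also have "\<dots> \<longleftrightarrow> E *v x = 0"
      using L0 by auto
    finally show ?thesis .
  qed
  then show ?thesis
    by (auto simp: *)
qed

subsection \<open>Real eigenpairs in invariant subspaces\<close>

text \<open>Induction on the degree of an annihilating polynomial: split off a root \<mu>. Either T
  z - \<mu> z vanishes and z is an eigenvector, or it is a nonzero element of \<open>U\<close>
  annihilated by the quotient.\<close>

lemma eigenvector_if_annihilated:
  fixes T :: "complex^'n^'n" and p :: "complex poly"
  assumes inv: "\<And>\<mu> z. z \<in> U \<Longrightarrow> T *v z - \<mu> *s z \<in> U"
    and "p \<noteq> 0" "z \<in> U" "z \<noteq> 0" "(\<Sum>i\<le>degree p. coeff p i *s (((*v) T) ^^ i) z) = 0"
  shows "\<exists>\<mu> v. v \<in> U \<and> v \<noteq> 0 \<and> T *v v = \<mu> *s v"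
  using assms(2-)
proof (induction "degree p" arbitrary: p z)
  case 0
  then have "coeff p 0 *s z = 0" "coeff p 0 \<noteq> 0"
    by (simp, metis leading_coeff_0_iff)
  with 0 show ?case by simp
next
  case (Suc d)
  obtain \<mu> where "poly p \<mu> = 0"
    using fundamental_theorem_of_algebra [of p] Suc.hyps(2) constant_degree [of p] by auto
  then obtain q where q: "p = [:- \<mu>, 1:] * q"
    by (metis dvdE poly_eq_0_iff_dvd)
  have "q \<noteq> 0"
    using q Suc.prems(1) by auto
  then have deg: "degree q = d"
    using Suc.hyps(2) by (simp add: q degree_mult_eq del: mult_pCons_left)
  define v where "v = T *v z - \<mu> *s z"
  let ?a = "\<lambda>i. (((*v) T) ^^ i) z"
  have pow: "(((*v) T) ^^ i) v = ?a (Suc i) - \<mu> *s ?a i" for i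
  proof (induction i)
    case (Suc i)
    then show ?case
      by (simp add: vec.diff vector_scalar_commute matrix_vector_mult_diff_distrib)
  qed (simp add: v_def)
  have "(\<Sum>i\<le>degree q. coeff q i *s (((*v) T) ^^ i) v)
      = (\<Sum>i\<le>d. coeff q i *s ?a (Suc i)) - (\<Sum>i\<le>d. (\<mu> * coeff q i) *s ?a i)"
    by (simp add: pow deg sum_subtractf [symmetric] vec_eq_iff algebra_simps)
  \<comment> \<open>Shifting the index exposes the coefficients of (X - \<mu>) q, where the
    coefficient of index i - 1 of q meets \<mu> times the one of index i. The guard at 0 is
    essential, since 0 - 1 = 0 on natural numbers.\<close>
  also have "(\<Sum>i\<le>d. coeff q i *s ?a (Suc i))
      = (\<Sum>i\<le>Suc d. (if i = 0 then 0 else coeff q (i - 1)) *s ?a i)"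
    by (subst sum.atMost_Suc_shift) simp
  also have "(\<Sum>i\<le>d. (\<mu> * coeff q i) *s ?a i) = (\<Sum>i\<le>Suc d. (\<mu> * coeff q i) *s ?a i)"
    by (simp add: coeff_eq_0 deg)
  also have "(\<Sum>i\<le>Suc d. (if i = 0 then 0 else coeff q (i - 1)) *s ?a i) - (\<Sum>i\<le>Suc d. (\<mu> * coeff q i) *s ?a i)
      = (\<Sum>i\<le>degree p. coeff p i *s ?a i)"
    unfolding Suc.hyps(2) [symmetric] sum_subtractf [symmetric]
    by (intro sum.cong) (auto simp: q coeff_pCons vec_eq_iff algebra_simps split: nat.splits)
  finally have *: "(\<Sum>i\<le>degree q. coeff q i *s (((*v) T) ^^ i) v) = 0"
    using Suc.prems(4) by simp
  show ?case
  proof (cases "v = 0")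
    case True
    then show ?thesis
      using Suc.prems(2,3) by (auto simp: v_def)
  next
    case False
    then show ?thesis
      using Suc.hyps(1) [of q v] deg * \<open>q \<noteq> 0\<close> inv [OF Suc.prems(2)] by (auto simp: v_def)
  qed
qed

text \<open>The first \<open>DIM('a) + 1\<close> terms are dependent, and the coefficients of a
  relation become those of \<open>p\<close>. Applied to the iterates of a matrix on a vector, this
  yields an annihilating polynomial.\<close>

lemma sequence_dependent:
  fixes u :: "nat \<Rightarrow> 'a::euclidean_space"
  obtains p :: "real poly" where "p \<noteq> 0" "(\<Sum>i\<le>degree p. coeff p i *\<^sub>R u i) = 0"
proof -
  let ?n = "DIM('a)"
  have "\<exists>c. (\<exists>i\<le>?n. c i \<noteq> 0) \<and> (\<Sum>i\<le>?n. c i *\<^sub>R u i) = 0"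
  proof (cases "inj_on u {..?n}")
    case True
    then have "dependent (u ` {..?n})"
      by (intro dependent_biggerset) (simp add: card_image)
    then obtain g where g: "\<exists>v\<in>u ` {..?n}. g v \<noteq> 0" "(\<Sum>v\<in>u ` {..?n}. g v *\<^sub>R v) = 0"
      by (auto simp: dependent_finite)
    then show ?thesis
      using True by (intro exI [of _ "g \<circ> u"]) (auto simp: sum.reindex)
  next
    \<comment> \<open>With a repeated vector the image set is too small for the counting argument;
      the relation u i - u j = 0 is used instead.\<close>
    case False
    then obtain i j where ij: "i \<le> ?n" "j \<le> ?n" "i \<noteq> j" "u i = u j"
      by (auto simp: inj_on_def)
    have "(\<Sum>k\<le>?n. ((if k = i then 1 else 0) - (if k = j then 1 else 0)) *\<^sub>R u k) = u i - u j"
      using ij(1,2) by (simp add: scaleR_diff_left sum_subtractf if_distrib [of "\<lambda>c. c *\<^sub>R _"] cong: if_cong)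
    then show ?thesis
      using ij by (intro exI [of _ "\<lambda>k. (if k = i then 1 else 0) - (if k = j then 1 else 0)"]) auto
  qed
  then obtain c k where ck: "k \<le> ?n" "c k \<noteq> 0" and c: "(\<Sum>i\<le>?n. c i *\<^sub>R u i) = 0"
    by blast
  define p where "p = (\<Sum>i\<le>?n. monom (c i) i)"
  have coeff: "coeff p i = (if i \<le> ?n then c i else 0)" for i
    by (simp add: p_def coeff_sum)
  have "degree p \<le> ?n"
    by (rule degree_le) (simp add: coeff)
  then have "(\<Sum>i\<le>degree p. coeff p i *\<^sub>R u i) = (\<Sum>i\<le>?n. coeff p i *\<^sub>R u i)"
    by (intro sum.mono_neutral_left) (auto simp: coeff_eq_0)
  also have "\<dots> = 0"
    using c by (simp add: coeff)
  finally have "(\<Sum>i\<le>degree p. coeff p i *\<^sub>R u i) = 0" .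
  moreover have "p \<noteq> 0"
    using ck coeff [of k] by (metis coeff_0)
  ultimately show thesis
    using that by blast
qed

text \<open>An eigenvector a + i b with eigenvalue \<sigma> + i \<omega> is found in the
  complexification \<open>U\<close> of \<open>V\<close>, starting from a real annihilating
  polynomial of \<open>w\<close>; its real and imaginary parts lie in \<open>V\<close>.\<close>

lemma invariant_subspace_eigenvector:
  fixes T :: "real^'n^'n"
  assumes V: "subspace V" "\<And>v. v \<in> V \<Longrightarrow> T *v v \<in> V" and w: "w \<in> V" "w \<noteq> 0"
  obtains \<sigma> \<omega> a b where "a \<in> V" "b \<in> V" "a \<noteq> 0 \<or> b \<noteq> 0"
    "T *v a = \<sigma> *\<^sub>R a - \<omega> *\<^sub>R b" "T *v b = \<omega> *\<^sub>R a + \<sigma> *\<^sub>R b"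
proof -
  obtain p where p: "p \<noteq> 0" "(\<Sum>i\<le>degree p. coeff p i *\<^sub>R (((*v) T) ^^ i) w) = 0"
    by (rule sequence_dependent [of "\<lambda>i. (((*v) T) ^^ i) w"])
  define Tc :: "complex^'n^'n" where "Tc = map_matrix of_real T"
  define pc where "pc = map_poly complex_of_real p"
  define U where "U = {cvec a b | a b. a \<in> V \<and> b \<in> V}"
  have pow: "(((*v) Tc) ^^ i) (cvec w 0) = cvec ((((*v) T) ^^ i) w) 0" for i
    by (induction i) (simp_all add: Tc_def map_matrix_cvec)
  have sum_cvec: "(\<Sum>i\<in>I. cvec (g i) 0) = cvec (\<Sum>i\<in>I. g i) 0" for I :: "nat set" and g :: "nat \<Rightarrow> real^'n"
    by (auto simp: vec_eq_iff cvec_def complex_eq_iff)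
  have "Tc *v z - \<mu> *s z \<in> U" if z: "z \<in> U" for \<mu> z
  proof -
    obtain a b where "a \<in> V" "b \<in> V" "z = cvec a b"
      using z unfolding U_def by blast
    then have "Tc *v z - \<mu> *s z = cvec (T *v a - (Re \<mu> *\<^sub>R a - Im \<mu> *\<^sub>R b)) (T *v b - (Im \<mu> *\<^sub>R a + Re \<mu> *\<^sub>R b))"
      by (simp add: Tc_def map_matrix_cvec smult_cvec) (simp add: cvec_def vec_eq_iff complex_eq_iff)
    then show ?thesis
      unfolding U_def using V \<open>a \<in> V\<close> \<open>b \<in> V\<close>
      by (blast intro: subspace_diff subspace_add subspace_scale)
  qed
  moreover have "pc \<noteq> 0"
    using p(1) by (simp add: pc_def map_poly_eq_0_iff)
  moreover have "cvec w 0 \<in> U"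
    unfolding U_def using w(1) subspace_0 [OF V(1)] by blast
  moreover have "cvec w 0 \<noteq> 0"
    using w by (simp add: cvec_eq_0_iff)
  moreover have "(\<Sum>i\<le>degree pc. coeff pc i *s (((*v) Tc) ^^ i) (cvec w 0)) = 0"
    using p(2) by (simp add: pow pc_def coeff_map_poly degree_map_poly smult_cvec sum_cvec cvec_eq_0_iff)
  ultimately obtain \<mu> v where "v \<in> U" "v \<noteq> 0" "Tc *v v = \<mu> *s v"
    using eigenvector_if_annihilated [of U Tc pc "cvec w 0"] by blast
  then obtain a b where "a \<in> V" "b \<in> V" "a \<noteq> 0 \<or> b \<noteq> 0"
    "T *v a = Re \<mu> *\<^sub>R a - Im \<mu> *\<^sub>R b" "T *v b = Im \<mu> *\<^sub>R a + Re \<mu> *\<^sub>R b"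
    by (auto simp: U_def Tc_def map_matrix_cvec smult_cvec cvec_eq_iff cvec_eq_0_iff)
  then show thesis
    using that by blast
qed

subsection \<open>Separation by a positive semidefinite matrix\<close>

definition outer :: "real^'m \<Rightarrow> real^'n \<Rightarrow> real^'n^'m" where
  "outer x y = (\<chi> i j. x $ i * y $ j)"

lemma outer_mult_vec: "outer x y *v v = (y \<bullet> v) *\<^sub>R x"
  by (simp add: outer_def matrix_vector_mult_def inner_vec_def vec_eq_iff sum_distrib_left
      sum_distrib_right ac_simps)

lemma outer_zero_left: "outer 0 y = 0"
  by (simp add: outer_def vec_eq_iff)

lemma transpose_outer: "transpose (outer x y) = outer y x"
  by (simp add: outer_def transpose_def vec_eq_iff mult.commute)

lemma mult_outer_mult: "M ** outer x y ** N = outer (M *v x) (transpose N *v y)"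
  by (simp add: matrix_eq mv_simps outer_mult_vec inner_transpose_left)

text \<open>The inner product of matrices is the Frobenius one, so pairing with rank-one matrices
  reads off the bilinear form of \<open>S\<close>.\<close>

lemma inner_outer: "S \<bullet> outer x y = x \<bullet> (S *v y)"
  by (simp add: inner_vec_def outer_def matrix_vector_mult_def sum_distrib_left ac_simps)

lemma matrix_mult_add_rdistrib: "(M + N) ** K = M ** K + N ** K" for K :: "real^'n^'m"
  by (simp add: matrix_eq mv_simps)

lemma mult_scaleR_right: "M ** (c *\<^sub>R N) = c *\<^sub>R (M ** N)" for M :: "real^'n^'m"
  by (simp add: matrix_eq mv_simps)

text \<open>A nonnegative quadratic that vanishes at 0 has slope 0 there; otherwise its value at the
  minimiser - b / (2 a) would be negative.\<close>

lemma linear_coeff_zero: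
  fixes a b :: real
  assumes "\<And>t. t\<^sup>2 * a + t * b \<ge> 0"
  shows "b = 0"
proof (rule ccontr)
  assume b: "b \<noteq> 0"
  have a: "a + b \<ge> 0" "a - b \<ge> 0"
    using assms [of 1] assms [of "-1"] by auto
  then have "a > 0" using b by linarith
  have "(- b / (2 * a))\<^sup>2 * a + (- b / (2 * a)) * b = - (b\<^sup>2 / (4 * a))"
    using \<open>a > 0\<close> by (simp add: field_simps power2_eq_square)
  moreover have "b\<^sup>2 / (4 * a) > 0"
    using \<open>a > 0\<close> b by simp
  ultimately show False
    using assms [of "- b / (2 * a)"] by simp
qed

text \<open>Along x + t S x the form has no constant term, so its linear coefficient, twice the
  squared norm of S x, must vanish.\<close>

lemma psd_kernel:
  fixes S :: "real^'n^'n"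
  assumes S: "transpose S = S" "\<And>v. v \<bullet> (S *v v) \<ge> 0" and x: "x \<bullet> (S *v x) = 0"
  shows "S *v x = 0"
proof (rule ccontr)
  let ?y = "S *v x"
  assume "?y \<noteq> 0"
  define a where "a = ?y \<bullet> ?y"
  define b where "b = ?y \<bullet> (S *v ?y)"
  have "a > 0"
    using \<open>?y \<noteq> 0\<close> by (simp add: a_def)
  have "x \<bullet> (S *v ?y) = a"
    using inner_transpose_left [of S x ?y] by (simp add: S(1) a_def)
  then have *: "(x + t *\<^sub>R ?y) \<bullet> (S *v (x + t *\<^sub>R ?y)) = 2 * t * a + t\<^sup>2 * b" for t
    by (simp add: mv_simps inner_add_left inner_add_right x a_def [symmetric] b_def [symmetric]
        power2_eq_square algebra_simps)
  have "2 * a = 0"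
    by (rule linear_coeff_zero [of b]) (use S(2) * in \<open>metis add.commute mult.assoc mult.commute\<close>)
  then show False
    using \<open>a > 0\<close> by simp
qed

text \<open>If x is orthogonal to the range, pairing it with S (S x) gives the squared norm of S x
  by symmetry, so x is in the kernel. Hence \<open>v\<close> lies in the double orthogonal
  complement of the range, which is the range itself.\<close>

lemma orthogonal_kernel_imp_range:
  fixes S :: "real^'n^'n"
  assumes S: "transpose S = S" and v: "\<And>x. S *v x = 0 \<Longrightarrow> x \<bullet> v = 0"
  shows "v \<in> range ((*v) S)"
proof -
  have sub: "subspace (range ((*v) S))"
    by (simp add: linear_subspace_image subspace_UNIV)
  have "v \<in> (range ((*v) S))\<^sup>\<bottom>\<^sup>\<bottom>"
    unfolding orthogonal_comp_def orthogonal_def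
  proof (clarify)
    fix x assume *: "\<forall>y\<in>range ((*v) S). y \<bullet> x = 0"
    then have "(S *v (S *v x)) \<bullet> x = 0"
      by blast
    then have "(S *v x) \<bullet> (S *v x) = 0"
      by (metis S inner_transpose_left)
    then show "x \<bullet> v = 0"
      using v by simp
  qed
  then show ?thesis
    using orthogonal_comp_self [OF sub] by simp
qed

lemma nonneg_if_scaled_bounded_below:
  fixes b c :: real
  assumes "\<And>t. t > 0 \<Longrightarrow> t * c \<ge> b"
  shows "c \<ge> 0"
proof (rule ccontr)
  assume "\<not> c \<ge> 0"
  then have c: "c < 0" by simp
  define t where "t = (\<bar>b\<bar> + 1) / - c"
  have "t > 0" "t * c = - (\<bar>b\<bar> + 1)"
    using c by (auto simp: t_def field_simps)
  then show False
    using assms [of t] by linarith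
qed

text \<open>Letting e tend to 0 removes the regularising multiples of the identity that keep test
  matrices strictly definite.\<close>

lemma nonneg_if_perturbed_nonneg:
  fixes c d :: real
  assumes "\<And>e. e > 0 \<Longrightarrow> c + e * d \<ge> 0"
  shows "c \<ge> 0"
proof -
  have "((\<lambda>e. c + e * d) \<longlongrightarrow> c + 0 * d) (at_right 0)"
    by (intro tendsto_intros)
  then show ?thesis
    by (intro tendsto_lowerbound [of _ _ "at_right 0"]) (auto intro!: eventually_at_right_less [THEN eventually_mono] assms)
qed

text \<open>A hyperplane separates \<open>K\<close> from the matrices with negative form. Both sets
  are closed under positive scaling, so the separating constant can be taken as 0.\<close>

lemma separating_functional_psd:
  fixes K :: "(real^'n^'n) set"
  assumes "convex K" "K \<noteq> {}" and scale: "\<And>M t. M \<in> K \<Longrightarrow> t > 0 \<Longrightarrow> t *\<^sub>R M \<in> K"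
    and notneg: "\<And>M. M \<in> K \<Longrightarrow> \<exists>x. x \<noteq> 0 \<and> x \<bullet> (M *v x) \<ge> 0"
  shows "\<exists>S. S \<noteq> 0 \<and> transpose S = S \<and> (\<forall>x. x \<bullet> (S *v x) \<ge> 0) \<and> (\<forall>M\<in>K. S \<bullet> M \<ge> 0)"
proof -
  define N :: "(real^'n^'n) set" where "N = {M. \<forall>x. x \<noteq> 0 \<longrightarrow> x \<bullet> (M *v x) < 0}"
  have negI: "- mat 1 \<in> N"
    by (simp add: N_def mv_simps)
  have Nscale: "t *\<^sub>R M \<in> N" if "M \<in> N" "t > 0" for t M
    using that by (auto simp: N_def mv_simps mult_pos_neg)
  have "convex N"
  proof (rule convexI)
    fix M M' :: "real^'n^'n" and u v :: real
    assume *: "M \<in> N" "M' \<in> N" "0 \<le> u" "0 \<le> v" "u + v = 1"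
    have "u * (x \<bullet> (M *v x)) + v * (x \<bullet> (M' *v x)) < 0" if "x \<noteq> 0" for x
      using * that by (intro convex_bound_lt) (auto simp: N_def)
    then show "u *\<^sub>R M + v *\<^sub>R M' \<in> N"
      by (auto simp: N_def mv_simps inner_add_right)
  qed
  moreover have "N \<inter> K = {}"
    using notneg by (force simp: N_def)
  ultimately obtain S b where "S \<noteq> 0" and SN: "\<And>M. M \<in> N \<Longrightarrow> S \<bullet> M \<le> b"
    and SK: "\<And>M. M \<in> K \<Longrightarrow> S \<bullet> M \<ge> b"
    using separating_hyperplane_sets [of N K] negI assms(1,2) by blast
  have K: "S \<bullet> M \<ge> 0" if "M \<in> K" for M
    by (rule nonneg_if_scaled_bounded_below [of b]) (use SK scale that in force)
  have N: "- (S \<bullet> M) \<ge> 0" if "M \<in> N" for M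
    by (rule nonneg_if_scaled_bounded_below [of "- b"]) (use SN Nscale that in force)
  have nonpos: "- (S \<bullet> M) \<ge> 0" if "\<And>x. x \<bullet> (M *v x) \<le> 0" for M
  proof (rule nonneg_if_perturbed_nonneg)
    fix e :: real
    assume "e > 0"
    have "x \<bullet> ((M + e *\<^sub>R (- mat 1)) *v x) < 0" if "x \<noteq> 0" for x
    proof -
      have "e * (x \<bullet> x) > 0"
        using \<open>e > 0\<close> that by simp
      then show ?thesis
        using \<open>\<And>x. x \<bullet> (M *v x) \<le> 0\<close> [of x] by (simp add: mv_simps inner_diff_right)
    qed
    then have "M + e *\<^sub>R (- mat 1) \<in> N"
      by (simp add: N_def)
    from N [OF this] show "- (S \<bullet> M) + e * (S \<bullet> mat 1) \<ge> 0"
      by (simp add: inner_diff_right)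
  qed
  \<comment> \<open>A skew matrix and its negative both have zero form, so the functional vanishes
    on skew matrices, which makes \<open>S\<close> symmetric. Below, minus a rank-one square gives
    semidefiniteness.\<close>
  have sym: "x \<bullet> (S *v y) = y \<bullet> (S *v x)" for x y
  proof -
    have "- (S \<bullet> (outer x y - outer y x)) \<ge> 0" "- (S \<bullet> (outer y x - outer x y)) \<ge> 0"
      by (rule nonpos; simp add: mv_simps outer_mult_vec inner_diff_right inner_commute)+
    then show ?thesis
      by (simp add: inner_diff_right inner_outer)
  qed
  have "transpose S = S"
  proof -
    have "x \<bullet> (transpose S *v y) = x \<bullet> (S *v y)" for x y
      by (simp add: inner_transpose_right sym)
    then have "transpose S *v y = S *v y" for y
      by (rule vector_eq_ldot [THEN iffD1, rule_format])
    then show ?thesis by (simp add: matrix_eq)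
  qed
  moreover have "x \<bullet> (S *v x) \<ge> 0" for x
  proof -
    have "- (S \<bullet> (- outer x x)) \<ge> 0"
      by (rule nonpos) (simp add: mv_simps outer_mult_vec inner_commute)
    then show ?thesis
      by (simp add: inner_outer)
  qed
  ultimately show ?thesis
    using \<open>S \<noteq> 0\<close> K by blast
qed

subsection \<open>Admissibility as a matrix inequality\<close>

lemma P_alpha_pos_combination:
  assumes "P \<in> P_alpha \<alpha>" "P' \<in> P_alpha \<alpha>" "u \<ge> 0" "v \<ge> 0" "u + v > 0"
  shows "u *\<^sub>R P + v *\<^sub>R P' \<in> P_alpha \<alpha>"
proof -
  obtain X Y where P: "P = sin (\<alpha> * pi / 2) *\<^sub>R X + cos (\<alpha> * pi / 2) *\<^sub>R Y"
    and XY: "transpose X = X" "transpose Y = - Y"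
    and pos: "\<And>x y. x \<noteq> 0 \<or> y \<noteq> 0 \<Longrightarrow> x \<bullet> (X *v x) + y \<bullet> (X *v y) + 2 * (x \<bullet> (Y *v y)) > 0"
    using assms(1) unfolding P_alpha_iff by blast
  obtain X' Y' where P': "P' = sin (\<alpha> * pi / 2) *\<^sub>R X' + cos (\<alpha> * pi / 2) *\<^sub>R Y'"
    and XY': "transpose X' = X'" "transpose Y' = - Y'"
    and pos': "\<And>x y. x \<noteq> 0 \<or> y \<noteq> 0 \<Longrightarrow> x \<bullet> (X' *v x) + y \<bullet> (X' *v y) + 2 * (x \<bullet> (Y' *v y)) > 0"
    using assms(2) unfolding P_alpha_iff by blast
  let ?X = "u *\<^sub>R X + v *\<^sub>R X'" and ?Y = "u *\<^sub>R Y + v *\<^sub>R Y'"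
  have "x \<bullet> (?X *v x) + y \<bullet> (?X *v y) + 2 * (x \<bullet> (?Y *v y)) > 0" if "x \<noteq> 0 \<or> y \<noteq> 0" for x y
  proof -
    have "x \<bullet> (?X *v x) + y \<bullet> (?X *v y) + 2 * (x \<bullet> (?Y *v y))
        = u * (x \<bullet> (X *v x) + y \<bullet> (X *v y) + 2 * (x \<bullet> (Y *v y)))
          + v * (x \<bullet> (X' *v x) + y \<bullet> (X' *v y) + 2 * (x \<bullet> (Y' *v y)))"
      by (simp add: mv_simps inner_add_right algebra_simps)
    moreover have "u > 0 \<or> v > 0"
      using assms by linarith
    ultimately show ?thesis
      using pos [OF that] pos' [OF that] assms(3,4)
      by (auto intro: add_pos_nonneg add_nonneg_pos)
  qed
  moreover have "transpose ?X = ?X" "transpose ?Y = - ?Y"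
    by (simp_all add: transpose_add transpose_scalar XY XY')
  moreover have "u *\<^sub>R P + v *\<^sub>R P' = sin (\<alpha> * pi / 2) *\<^sub>R ?X + cos (\<alpha> * pi / 2) *\<^sub>R ?Y"
    by (simp add: P P' algebra_simps)
  ultimately show ?thesis
    unfolding P_alpha_iff by blast
qed

lemma scaleR_P_alpha: "P \<in> P_alpha \<alpha> \<Longrightarrow> t > 0 \<Longrightarrow> t *\<^sub>R P \<in> P_alpha \<alpha>"
  using P_alpha_pos_combination [of P \<alpha> P t 0] by simp

text \<open>The rank-one Hermitian matrix \<open>v v\<^sup>*\<close> with \<open>v = x + \<i> y\<close>, regularised.\<close>
lemma rank_one_P_alpha:
  assumes "e > 0"
  shows "sin (\<alpha> * pi / 2) *\<^sub>R (outer x x + outer y y + e *\<^sub>R mat 1)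
    + cos (\<alpha> * pi / 2) *\<^sub>R (outer x y - outer y x) \<in> P_alpha \<alpha>"
proof -
  let ?X = "outer x x + outer y y + e *\<^sub>R mat 1" and ?Y = "outer x y - outer y x"
  have "p \<bullet> (?X *v p) + q \<bullet> (?X *v q) + 2 * (p \<bullet> (?Y *v q)) > 0" if "p \<noteq> 0 \<or> q \<noteq> 0" for p q
  proof -
    have "p \<bullet> (?X *v p) + q \<bullet> (?X *v q) + 2 * (p \<bullet> (?Y *v q))
        = (x \<bullet> p + y \<bullet> q)\<^sup>2 + (y \<bullet> p - x \<bullet> q)\<^sup>2 + e * (p \<bullet> p + q \<bullet> q)"
      by (simp add: mv_simps outer_mult_vec inner_add_right inner_diff_right inner_commute
          power2_eq_square algebra_simps)
    moreover have "p \<bullet> p + q \<bullet> q > 0"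
      using that by (metis add_nonneg_pos add_pos_nonneg inner_ge_zero inner_gt_zero_iff)
    ultimately show ?thesis
      using assms by (simp add: add_nonneg_pos)
  qed
  moreover have "transpose ?X = ?X" "transpose ?Y = - ?Y"
    by (simp_all add: transpose_add transpose_diff transpose_scalar transpose_outer)
  ultimately show ?thesis
    unfolding P_alpha_iff by blast
qed

text \<open>The equations say E v = \<mu> A v for v = x + i y and \<mu> = \<sigma> + i \<omega>, so
  1 / \<mu> is a root of the pencil. It is a positive multiple of the conjugate of \<mu>, and the
  sector is symmetric about the real axis.\<close>

lemma not_frac_stable_if_reversed_eigenvector:
  assumes \<alpha>: "0 < \<alpha>" "\<alpha> < 1" and xy: "x \<noteq> 0 \<or> y \<noteq> 0" and "\<sigma> \<noteq> 0 \<or> \<omega> \<noteq> 0"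
    and sector: "cos (\<alpha> * pi / 2) * \<bar>\<omega>\<bar> \<le> sin (\<alpha> * pi / 2) * \<sigma>"
    and E: "E *v x = \<sigma> *\<^sub>R (A *v x) - \<omega> *\<^sub>R (A *v y)" "E *v y = \<omega> *\<^sub>R (A *v x) + \<sigma> *\<^sub>R (A *v y)"
  shows "\<not> frac_stable \<alpha> E A"
proof -
  define d where "d = \<sigma>\<^sup>2 + \<omega>\<^sup>2"
  have "d > 0"
    using assms(4) by (auto simp: d_def sum_power2_gt_zero_iff)
  define z where "z = Complex (\<sigma> / d) (- \<omega> / d)"
  have "A *v x = Re z *\<^sub>R (E *v x) - Im z *\<^sub>R (E *v y)"
  proof -
    have "Re z *\<^sub>R (E *v x) - Im z *\<^sub>R (E *v y) = ((\<sigma>\<^sup>2 + \<omega>\<^sup>2) / d) *\<^sub>R (A *v x)"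
      by (simp add: z_def E scaleR_add_right scaleR_diff_right power2_eq_square add_divide_distrib
          scaleR_add_left mult.commute)
    then show ?thesis using \<open>d > 0\<close> by (simp flip: d_def)
  qed
  moreover have "A *v y = Im z *\<^sub>R (E *v x) + Re z *\<^sub>R (E *v y)"
  proof -
    have "Im z *\<^sub>R (E *v x) + Re z *\<^sub>R (E *v y) = ((\<sigma>\<^sup>2 + \<omega>\<^sup>2) / d) *\<^sub>R (A *v y)"
      by (simp add: z_def E scaleR_add_right scaleR_diff_right power2_eq_square add_divide_distrib
          scaleR_add_left mult.commute)
    then show ?thesis using \<open>d > 0\<close> by (simp flip: d_def)
  qed
  ultimately have "poly (map_poly complex_of_real (pencil_det E A)) z = 0"
    unfolding pencil_root_iff using xy by blast
  moreover have "\<bar>Arg z\<bar> \<le> \<alpha> * pi / 2"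
  proof -
    have "cos (\<alpha> * pi / 2) * \<bar>\<omega>\<bar> / d \<le> sin (\<alpha> * pi / 2) * \<sigma> / d"
      using sector \<open>d > 0\<close> by (intro divide_right_mono) auto
    then show ?thesis
      using \<alpha> \<open>d > 0\<close> by (subst abs_Arg_le_iff) (auto simp: z_def abs_divide)
  qed
  ultimately show ?thesis
    unfolding frac_stable_def by force
qed

text \<open>A kernel vector of \<open>A\<close> makes 0 a root, and \<open>Arg 0 = 0\<close>
  violates the stability condition.\<close>

lemma frac_stable_imp_nonsingular:
  assumes "0 < \<alpha>" "frac_stable \<alpha> E A" "A *v x = 0"
  shows "x = 0"
proof (rule ccontr)
  assume "x \<noteq> 0"
  then have "poly (map_poly complex_of_real (pencil_det E A)) 0 = 0"
    unfolding pencil_root_iff using assms(3) by (intro exI [of _ x] exI [of _ 0]) simp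
  then have "\<bar>Arg 0\<bar> > \<alpha> * pi / 2"
    using assms(2) unfolding frac_stable_def by blast
  moreover have "\<alpha> * pi / 2 > 0"
    using assms(1) by simp
  ultimately show False
    by (simp add: Arg_zero)
qed

lemma admissible_imp_lmi:
  fixes E A :: "real^'n^'n" and N :: "real^'n^'k"
  assumes \<alpha>: "0 < \<alpha>" "\<alpha> < 1"
    and N: "rank N = CARD('k)" "N ** E = 0" "CARD('k) = CARD('n) - rank E"
    and adm: "admissible \<alpha> E A"
  shows "\<exists>P\<in>P_alpha \<alpha>. \<exists>Q :: real^'k^'n.
    \<forall>x. x \<noteq> 0 \<longrightarrow> x \<bullet> ((transpose E ** P ** A + Q ** N ** A) *v x) < 0"
proof (rule ccontr)
  assume contra: "\<not> ?thesis"
  then have no: "\<exists>x. x \<noteq> 0 \<and> x \<bullet> ((transpose E ** P ** A + Q ** N ** A) *v x) \<ge> 0"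
    if "P \<in> P_alpha \<alpha>" for P and Q :: "real^'k^'n"
    using that contra by (meson not_less)
  define s where "s = sin (\<alpha> * pi / 2)"
  define c where "c = cos (\<alpha> * pi / 2)"
  have "c > 0"
    unfolding c_def using \<alpha> by (intro cos_gt_zero) auto
  have stable: "frac_stable \<alpha> E A"
    using adm by (simp add: admissible_def)
  have ker: "x = 0" if "E *v x = 0" "N *v (A *v x) = 0" for x
    using adm regular_impulse_free_iff [OF N, of A] that by (auto simp: admissible_def)
  have "invertible A"
    using frac_stable_imp_nonsingular [OF \<alpha>(1) stable]
    by (metis invertible_left_inverse matrix_left_invertible_ker)
  then obtain B where AB: "A ** B = mat 1" and BA: "B ** A = mat 1"
    by (auto simp: invertible_def)
  have ABv: "A *v (B *v x) = x" and BAv: "B *v (A *v x) = x" for x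
    by (simp_all add: matrix_vector_mul_assoc AB BA)
  define K where "K = {transpose E ** P ** A + Q ** N ** A | P Q. P \<in> P_alpha \<alpha>}"
  have "convex K"
  proof (rule convexI)
    fix M M' :: "real^'n^'n" and u v :: real
    assume uv: "M \<in> K" "M' \<in> K" "0 \<le> u" "0 \<le> v" "u + v = 1"
    then obtain P Q P' Q' where "P \<in> P_alpha \<alpha>" "P' \<in> P_alpha \<alpha>"
      "M = transpose E ** P ** A + Q ** N ** A" "M' = transpose E ** P' ** A + Q' ** N ** A"
      unfolding K_def by blast
    moreover from this have "u *\<^sub>R M + v *\<^sub>R M'
        = transpose E ** (u *\<^sub>R P + v *\<^sub>R P') ** A + (u *\<^sub>R Q + v *\<^sub>R Q') ** N ** A"
      by (simp add: matrix_eq mv_simps algebra_simps)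
    moreover have "u *\<^sub>R P + v *\<^sub>R P' \<in> P_alpha \<alpha>"
      using \<open>P \<in> P_alpha \<alpha>\<close> \<open>P' \<in> P_alpha \<alpha>\<close> uv(3-5) by (simp add: P_alpha_pos_combination)
    ultimately show "u *\<^sub>R M + v *\<^sub>R M' \<in> K"
      unfolding K_def by blast
  qed
  moreover have "K \<noteq> {}"
    using rank_one_P_alpha [OF zero_less_one] unfolding K_def by blast
  moreover have "t *\<^sub>R M \<in> K" if M: "M \<in> K" and "t > 0" for M t
  proof -
    obtain P Q where "P \<in> P_alpha \<alpha>" "M = transpose E ** P ** A + Q ** N ** A"
      using M unfolding K_def by blast
    moreover from this have "t *\<^sub>R M = transpose E ** (t *\<^sub>R P) ** A + (t *\<^sub>R Q) ** N ** A"
      by (simp add: matrix_eq mv_simps algebra_simps)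
    ultimately show ?thesis
      unfolding K_def using scaleR_P_alpha \<open>t > 0\<close> by blast
  qed
  moreover have "\<exists>x. x \<noteq> 0 \<and> x \<bullet> (M *v x) \<ge> 0" if "M \<in> K" for M
    using no that unfolding K_def by blast
  ultimately have "\<exists>S. S \<noteq> 0 \<and> transpose S = S \<and> (\<forall>x. x \<bullet> (S *v x) \<ge> 0) \<and> (\<forall>M\<in>K. S \<bullet> M \<ge> 0)"
    by (rule separating_functional_psd)
  then obtain S where "S \<noteq> 0" and symS: "transpose S = S" and psd: "\<And>x. x \<bullet> (S *v x) \<ge> 0"
    and SK: "\<And>M. M \<in> K \<Longrightarrow> S \<bullet> M \<ge> 0"
    by blast
  have Scomm: "x \<bullet> (S *v y) = y \<bullet> (S *v x)" for x y
    by (metis inner_transpose_right symS)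
  define T where "T = B ** E"
  have AT: "A *v (T *v x) = E *v x" for x
    by (simp add: T_def ABv flip: matrix_vector_mul_assoc)
  \<comment> \<open>For v = x + i y, the real and imaginary parts of v^* T S v are
    \<open>h x x + h y y\<close> and \<open>h x y - h y x\<close>. The aim is that this number
    always lies in the closed sector.\<close>
  define h where "h x y = x \<bullet> (T *v (S *v y))" for x y
  define P where "P x y e = s *\<^sub>R (outer x x + outer y y + e *\<^sub>R mat 1) + c *\<^sub>R (outer x y - outer y x)"
    for x y :: "real^'n" and e
  have P: "P x y e \<in> P_alpha \<alpha>" if "e > 0" for x y e
    using rank_one_P_alpha [OF that] by (simp add: P_def s_def c_def)
  \<comment> \<open>Pulling the test vectors back through \<open>transpose B\<close> cancels
    \<open>A\<close> on the right and turns \<open>E\<close> into \<open>T\<close> on the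
    left.\<close>
  have outer_h: "S \<bullet> (transpose E ** outer (transpose B *v x) (transpose B *v y) ** A) = h x y" for x y
  proof -
    have "transpose A *v (transpose B *v y) = y"
      by (metis BA matrix_transpose_mul matrix_vector_mul_assoc matrix_vector_mul_lid transpose_mat AB)
    then have "S \<bullet> (transpose E ** outer (transpose B *v x) (transpose B *v y) ** A)
        = (transpose E *v (transpose B *v x)) \<bullet> (S *v y)"
      by (simp add: mult_outer_mult inner_outer)
    then show ?thesis
      by (simp add: h_def T_def inner_transpose_left flip: matrix_vector_mul_assoc)
  qed
  have h: "s * (h x x + h y y) + c * (h x y - h y x) \<ge> 0" for x y
  proof (rule nonneg_if_perturbed_nonneg)
    fix e :: real assume "e > 0"
    let ?x = "transpose B *v x" and ?y = "transpose B *v y"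
    have "transpose E ** P ?x ?y e ** A + 0 ** N ** A \<in> K"
      unfolding K_def using P [OF \<open>e > 0\<close>] by blast
    then have "S \<bullet> (transpose E ** P ?x ?y e ** A) \<ge> 0"
      using SK by fastforce
    also have "transpose E ** P ?x ?y e ** A
        = s *\<^sub>R (transpose E ** outer ?x ?x ** A + transpose E ** outer ?y ?y ** A + e *\<^sub>R (transpose E ** A))
          + c *\<^sub>R (transpose E ** outer ?x ?y ** A - transpose E ** outer ?y ?x ** A)"
      by (simp add: P_def matrix_eq mv_simps algebra_simps)
    finally show "s * (h x x + h y y) + c * (h x y - h y x) + e * (s * (S \<bullet> (transpose E ** A))) \<ge> 0"
      by (simp add: inner_add_right inner_diff_right outer_h algebra_simps)
  qed
  \<comment> \<open>Testing with \<open>Q\<close> equal to - v u^T, where u is the vector to be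
    shown zero, and with only the regularising part of \<open>P\<close>, leaves - u^T u \<ge> 0 in
    the limit.\<close>
  have NS: "N *v (A *v (S *v v)) = 0" for v
  proof -
    let ?u = "N *v (A *v (S *v v))"
    have "S \<bullet> (transpose E ** P 0 0 e ** A + (- outer v ?u) ** N ** A) \<ge> 0" if "e > 0" for e
      using SK P [OF that] unfolding K_def by blast
    moreover have "transpose E ** P 0 0 e ** A + (- outer v ?u) ** N ** A
        = e *\<^sub>R s *\<^sub>R (transpose E ** A) - outer v (transpose A *v (transpose N *v ?u))" for e
      by (simp add: P_def outer_zero_left matrix_eq mv_simps outer_mult_vec inner_transpose_left mult.commute)
    ultimately have "- (v \<bullet> (S *v (transpose A *v (transpose N *v ?u)))) + e * (s * (S \<bullet> (transpose E ** A))) \<ge> 0"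
      if "e > 0" for e
      using that by (simp add: inner_diff_right inner_outer mult.assoc)
    then have "- (v \<bullet> (S *v (transpose A *v (transpose N *v ?u)))) \<ge> 0"
      by (rule nonneg_if_perturbed_nonneg)
    also have "v \<bullet> (S *v (transpose A *v (transpose N *v ?u))) = ?u \<bullet> ?u"
      by (subst Scomm) (simp add: inner_transpose_left)
    finally have "?u \<bullet> ?u \<le> 0"
      by (simp only: neg_0_le_iff_le)
    then show ?thesis
      by (metis inner_gt_zero_iff not_less)
  qed
  \<comment> \<open>For x in the kernel of \<open>S\<close>, the inequality at (x, t y) is a
    quadratic in t without constant term; its slope \<open>c * h x y\<close> must vanish. So T S y
    is orthogonal to the kernel.\<close>
  have TV: "T *v v \<in> range ((*v) S)" if v: "v \<in> range ((*v) S)" for v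
  proof -
    obtain y where y: "v = S *v y"
      using v by blast
    show ?thesis
    proof (rule orthogonal_kernel_imp_range [OF symS])
      fix x assume x: "S *v x = 0"
      have "t\<^sup>2 * (s * h y y) + t * (c * h x y) \<ge> 0" for t
        using h [of x "t *\<^sub>R y"] x
        by (simp add: h_def mv_simps power2_eq_square algebra_simps)
      then have "c * h x y = 0"
        by (rule linear_coeff_zero)
      then show "x \<bullet> (T *v v) = 0"
        using \<open>c > 0\<close> by (simp add: h_def y)
    qed
  qed
  have sub: "subspace (range ((*v) S))"
    by (simp add: linear_subspace_image subspace_UNIV)
  obtain w where w: "S *v w \<noteq> 0"
    using \<open>S \<noteq> 0\<close> matrix_eq [of S 0] by auto
  obtain \<sigma> \<omega> a b where ab: "a \<in> range ((*v) S)" "b \<in> range ((*v) S)" "a \<noteq> 0 \<or> b \<noteq> 0"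
    and Ta: "T *v a = \<sigma> *\<^sub>R a - \<omega> *\<^sub>R b" and Tb: "T *v b = \<omega> *\<^sub>R a + \<sigma> *\<^sub>R b"
    by (rule invariant_subspace_eigenvector [OF sub TV rangeI w])
  obtain x y where x: "a = S *v x" and y: "b = S *v y"
    using ab(1,2) by blast
  \<comment> \<open>With a + i b = S w and w = x + i y, \<open>k\<close> is w^* S w, positive by
    semidefiniteness. Since T S w = \<mu> S w for \<mu> = \<sigma> + i \<omega>, the number w^* T S
    w is \<mu> k.\<close>
  define k where "k = x \<bullet> a + y \<bullet> b"
  have "k > 0"
  proof -
    have "x \<bullet> a > 0" if "a \<noteq> 0"
      using psd_kernel [OF symS psd, of x] psd [of x] that by (fastforce simp: x)
    moreover have "y \<bullet> b > 0" if "b \<noteq> 0"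
      using psd_kernel [OF symS psd, of y] psd [of y] that by (fastforce simp: y)
    ultimately show ?thesis
      using ab(3) psd [of x] psd [of y] by (auto simp: k_def x y add_pos_nonneg add_nonneg_pos)
  qed
  have xb: "x \<bullet> b = y \<bullet> a"
    unfolding x y by (rule Scomm)
  have hs: "h x x + h y y = \<sigma> * k" "h x y - h y x = \<omega> * k"
    using xb by (simp_all add: h_def Ta Tb k_def inner_add_right inner_diff_right algebra_simps flip: x y)
  \<comment> \<open>Swapping x and y reverses only the imaginary part, which yields the bound on
    both sides of the real axis.\<close>
  have "k * (s * \<sigma> + c * \<omega>) \<ge> 0" "k * (s * \<sigma> - c * \<omega>) \<ge> 0"
    using h [of x y] h [of y x] hs by (simp_all add: algebra_simps)
  then have "s * \<sigma> + c * \<omega> \<ge> 0" "s * \<sigma> - c * \<omega> \<ge> 0"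
    using \<open>k > 0\<close> by (simp_all add: zero_le_mult_iff)
  then have sector: "c * \<bar>\<omega>\<bar> \<le> s * \<sigma>"
    by (auto simp: abs_if)
  have Ea: "E *v a = \<sigma> *\<^sub>R (A *v a) - \<omega> *\<^sub>R (A *v b)" and Eb: "E *v b = \<omega> *\<^sub>R (A *v a) + \<sigma> *\<^sub>R (A *v b)"
    by (simp_all add: Ta Tb mv_simps flip: AT)
  show False
  proof (cases "\<sigma> = 0 \<and> \<omega> = 0")
    case True
    then have "E *v a = 0" "E *v b = 0"
      by (simp_all add: Ea Eb)
    then show ?thesis
      using ker [of a] ker [of b] NS x y ab(3) by auto
  next
    case False
    then show ?thesis
      using not_frac_stable_if_reversed_eigenvector [OF \<alpha> ab(3) _ _ Ea Eb] sector stable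
      by (auto simp: s_def c_def)
  qed
qed

text \<open>For a root z with eigenvector v = x + i y, the \<open>Q\<close> term drops out because N
  A v = z N E v = 0. The forms at x and y add up to an expression in E v alone, controlled by the
  Hermitian matrix behind \<open>P\<close>.\<close>

lemma lmi_imp_admissible:
  fixes E A :: "real^'n^'n" and N :: "real^'n^'k"
  assumes \<alpha>: "0 < \<alpha>" "\<alpha> < 1"
    and N: "rank N = CARD('k)" "N ** E = 0" "CARD('k) = CARD('n) - rank E"
    and "P \<in> P_alpha \<alpha>"
    and neg: "\<And>x. x \<noteq> 0 \<Longrightarrow> x \<bullet> ((transpose E ** P ** A + Q ** N ** A) *v x) < 0"
  shows "admissible \<alpha> E A"
proof -
  define s where "s = sin (\<alpha> * pi / 2)"
  define c where "c = cos (\<alpha> * pi / 2)"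
  have "s > 0" "c > 0"
    unfolding s_def c_def using \<alpha> by (auto intro!: sin_gt_zero cos_gt_zero)
  obtain X Y where P: "P = s *\<^sub>R X + c *\<^sub>R Y" and XY: "transpose X = X" "transpose Y = - Y"
    and pos: "\<And>x y. x \<noteq> 0 \<or> y \<noteq> 0 \<Longrightarrow> x \<bullet> (X *v x) + y \<bullet> (X *v y) + 2 * (x \<bullet> (Y *v y)) > 0"
    using assms(6) unfolding P_alpha_iff s_def c_def by blast
  have form: "x \<bullet> ((transpose E ** P ** A + Q ** N ** A) *v x)
      = (E *v x) \<bullet> (P *v (A *v x)) + x \<bullet> (Q *v (N *v (A *v x)))" for x
    by (simp add: mv_simps inner_add_right flip: inner_transpose_left)
  have NE: "N *v (E *v x) = 0" for x
    by (simp add: matrix_vector_mul_assoc N(2))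
  have "x = 0" if "E *v x = 0" "N *v (A *v x) = 0" for x
    using neg [of x] form [of x] that by auto
  then have "regular_pencil E A \<and> impulse_free E A"
    using regular_impulse_free_iff [OF N, of A] by blast
  moreover have "frac_stable \<alpha> E A"
    unfolding frac_stable_def
  proof (intro allI impI, rule ccontr)
    fix z assume root: "poly (map_poly complex_of_real (pencil_det E A)) z = 0"
      and "\<not> \<bar>Arg z\<bar> > \<alpha> * pi / 2"
    then have "c * \<bar>Im z\<bar> \<le> s * Re z"
      using abs_Arg_le_iff [of "\<alpha> * pi / 2" z] \<alpha> by (simp add: s_def c_def)
    obtain x y where xy: "x \<noteq> 0 \<or> y \<noteq> 0"
      and Ax: "A *v x = Re z *\<^sub>R (E *v x) - Im z *\<^sub>R (E *v y)"
      and Ay: "A *v y = Im z *\<^sub>R (E *v x) + Re z *\<^sub>R (E *v y)"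
      using root unfolding pencil_root_iff by blast
    define p where "p = E *v x"
    define q where "q = E *v y"
    define a where "a = p \<bullet> (X *v p) + q \<bullet> (X *v q)"
    define b where "b = 2 * (p \<bullet> (Y *v q))"
    have skew: "u \<bullet> (Y *v v) = - (v \<bullet> (Y *v u))" for u v
      using inner_transpose_right [of u Y v] by (simp add: XY mv_simps)
    have Xsym: "u \<bullet> (X *v v) = v \<bullet> (X *v u)" for u v
      using inner_transpose_right [of u X v] by (simp add: XY)
    have skew0: "u \<bullet> (Y *v u) = 0" for u
      using skew [of u u] by simp
    \<comment> \<open>Positivity at (p, q) and at (p, - q) bounds \<open>b\<close> from both
      sides.\<close>
    have "\<bar>b\<bar> \<le> a"
    proof (cases "p = 0 \<and> q = 0")
      case False
      then show ?thesis
        using pos [of p q] pos [of p "- q"] by (simp add: a_def b_def mv_simps abs_if)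
    qed (simp add: a_def b_def)
    have "x \<bullet> ((transpose E ** P ** A + Q ** N ** A) *v x) + y \<bullet> ((transpose E ** P ** A + Q ** N ** A) *v y) < 0"
      using xy neg [of x] neg [of y] by (cases "x = 0"; cases "y = 0") auto
    also have "x \<bullet> ((transpose E ** P ** A + Q ** N ** A) *v x) + y \<bullet> ((transpose E ** P ** A + Q ** N ** A) *v y)
        = p \<bullet> (P *v (Re z *\<^sub>R p - Im z *\<^sub>R q)) + q \<bullet> (P *v (Im z *\<^sub>R p + Re z *\<^sub>R q))"
      unfolding form by (simp add: Ax Ay NE mv_simps p_def q_def)
    also have "\<dots> = Re z * s * a - Im z * c * b"
      using skew [of q p] Xsym [of q p]
      by (simp add: P mv_simps inner_add_right inner_diff_right skew0 a_def b_def algebra_simps)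
    finally have "Re z * s * a - Im z * c * b < 0" .
    moreover have "Im z * c * b \<le> \<bar>Im z\<bar> * c * a"
    proof -
      have "Im z * c * b \<le> \<bar>Im z * c * b\<bar>" by simp
      also have "\<dots> = (\<bar>Im z\<bar> * c) * \<bar>b\<bar>" using \<open>c > 0\<close> by (simp add: abs_mult)
      also have "\<dots> \<le> (\<bar>Im z\<bar> * c) * a" using \<open>\<bar>b\<bar> \<le> a\<close> \<open>c > 0\<close> by (intro mult_left_mono) auto
      finally show ?thesis .
    qed
    moreover have "(s * Re z - c * \<bar>Im z\<bar>) * a \<ge> 0"
      using \<open>c * \<bar>Im z\<bar> \<le> s * Re z\<close> \<open>\<bar>b\<bar> \<le> a\<close> by (intro mult_nonneg_nonneg) auto
    ultimately show False
      by (simp add: algebra_simps)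
  qed
  ultimately show ?thesis
    by (simp add: admissible_def)
qed

subsection \<open>Output feedback\<close>

lemma inner_msym: "x \<bullet> (msym M *v x) = 2 * (x \<bullet> (M *v x))"
  by (simp add: msym_def mv_simps inner_add_right inner_transpose_right)

lemma transpose_msym: "transpose (msym M) = msym M"
  by (simp add: msym_def transpose_add add.commute)

lemma
  fixes M :: "real^'n^'n"
  assumes "invertible M"
  shows matrix_inv_right: "M ** matrix_inv M = mat 1"
    and matrix_inv_left: "matrix_inv M ** M = mat 1"
  using assms someI_ex [of "\<lambda>M'. M ** M' = mat 1 \<and> M' ** M = mat 1"]
  unfolding invertible_def matrix_inv_def by blast+

text \<open>Finsler's lemma on pairs (x, y) with y^T y as the nonnegative form: on its zero set only
  the negative form of \<open>\<Phi>\<close> remains.\<close>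

lemma large_scalar_block_exists:
  fixes \<Phi> :: "real^'n^'n" and S :: "real^'m^'n"
  assumes neg: "\<And>x. x \<noteq> 0 \<Longrightarrow> x \<bullet> (\<Phi> *v x) < 0"
  obtains g where "g > 0" "\<And>x y. x \<noteq> 0 \<or> y \<noteq> 0 \<Longrightarrow> x \<bullet> (\<Phi> *v x) + x \<bullet> (S *v y) - g * (y \<bullet> y) < 0"
proof -
  let ?f = "\<lambda>z :: (real^'n) \<times> (real^'m). fst z \<bullet> (\<Phi> *v fst z) + fst z \<bullet> (S *v snd z)"
  let ?h = "\<lambda>z :: (real^'n) \<times> (real^'m). snd z \<bullet> snd z"
  have "continuous_on UNIV ?f" "continuous_on UNIV ?h"
    by (intro continuous_intros bounded_linear.continuous_on [OF matrix_vector_mul_bounded_linear])+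
  then obtain g where "g > 0" and g: "\<And>z. z \<noteq> 0 \<Longrightarrow> ?f z - g * ?h z < 0"
  proof (rule finsler_homogeneous)
    show "?f (c *\<^sub>R z) = c\<^sup>2 * ?f z" "?h (c *\<^sub>R z) = c\<^sup>2 * ?h z" for c z
      by (simp_all add: mv_simps power2_eq_square algebra_simps)
    show "?f z < 0" if "z \<noteq> 0" "?h z = 0" for z
      using that neg [of "fst z"] by (cases z) (auto simp: zero_prod_def)
  qed auto
  have "x \<bullet> (\<Phi> *v x) + x \<bullet> (S *v y) - g * (y \<bullet> y) < 0" if "x \<noteq> 0 \<or> y \<noteq> 0" for x y
    using g [of "(x, y)"] that by (simp add: zero_prod_def)
  with \<open>g > 0\<close> show thesis
    using that by blast
qed

text \<open>At u = (F C - K0) x with G F = H, the terms H C x - G K0 x combine to G u. Hence the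
  off-diagonal contribution cancels that of the lower right block, and S B u turns the gain
  \<open>K0\<close> into F C.\<close>

lemma block_lmi_imp_closed_loop:
  fixes S A :: "real^'n^'n" and B :: "real^'m^'n" and C :: "real^'n^'p"
    and G :: "real^'m^'m" and H :: "real^'p^'m" and K0 :: "real^'n^'m"
  assumes neg: "neg_def (block2 (msym (S ** (A + B ** K0)))
      (S ** B + transpose C ** transpose H - transpose K0 ** transpose G)
      (transpose (S ** B + transpose C ** transpose H - transpose K0 ** transpose G))
      (- G - transpose G))"
    and "x \<noteq> 0"
  shows "x \<bullet> (S ** (A + B ** (matrix_inv G ** H) ** C) *v x) < 0"
proof -
  let ?R = "S ** B + transpose C ** transpose H - transpose K0 ** transpose G"
  have R: "x \<bullet> (?R *v u) = x \<bullet> (S *v (B *v u)) + u \<bullet> (H *v (C *v x)) - u \<bullet> (G *v (K0 *v x))" for x u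
    by (simp add: mv_simps inner_add_right inner_diff_right inner_transpose_right)
      (simp add: inner_commute [of _ u] inner_transpose_right inner_transpose_left)
  have GG: "y \<bullet> ((- G - transpose G) *v y) = - 2 * (y \<bullet> (G *v y))" for y
    by (simp add: mv_simps inner_diff_right inner_transpose_right)
  have *: "2 * (x \<bullet> (S ** (A + B ** K0) *v x)) + 2 * (x \<bullet> (?R *v y)) - 2 * (y \<bullet> (G *v y)) < 0"
    if "x \<noteq> 0 \<or> y \<noteq> 0" for x y
    using neg that unfolding neg_def_block2_iff inner_msym GG by fastforce
  \<comment> \<open>Setting x = 0 isolates the lower right block, which forces \<open>G\<close> to
    be invertible and \<open>matrix_inv G\<close> to be a genuine inverse.\<close>
  have "y \<bullet> (- G *v y) < 0" if "y \<noteq> 0" for y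
    using * [of 0 y] that by (simp add: mv_simps)
  then have "invertible (- G)"
    by (rule neg_form_imp_invertible)
  then have "\<forall>y. - G *v y = 0 \<longrightarrow> y = 0"
    by (metis invertible_left_inverse matrix_left_invertible_ker)
  then have "\<forall>y. G *v y = 0 \<longrightarrow> y = 0"
    by (simp add: mv_simps)
  then have "invertible G"
    by (metis invertible_left_inverse matrix_left_invertible_ker)
  define F where "F = matrix_inv G ** H"
  have "G ** F = H"
    by (simp add: F_def matrix_mul_assoc matrix_inv_right \<open>invertible G\<close>)
  then have H: "H *v v = G *v (F *v v)" for v
    by (metis matrix_vector_mul_assoc)
  define u where "u = F *v (C *v x) - K0 *v x"
  have "2 * (x \<bullet> (S ** (A + B ** K0) *v x)) + 2 * (x \<bullet> (?R *v u)) - 2 * (u \<bullet> (G *v u))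
      = 2 * (x \<bullet> (S ** (A + B ** F ** C) *v x))"
    unfolding R H by (simp add: u_def mv_simps inner_add_right inner_diff_right inner_diff_left)
  then show ?thesis
    using * [of x u] \<open>x \<noteq> 0\<close> by (simp add: F_def)
qed

text \<open>With K0 = F C and H = G F the terms containing \<open>C\<close> cancel and the
  off-diagonal block is just S B; a large scalar \<open>G\<close> then dominates it.\<close>

lemma closed_loop_imp_block_lmi:
  fixes S A :: "real^'n^'n" and B :: "real^'m^'n" and C :: "real^'n^'p" and F :: "real^'p^'m"
  assumes neg: "\<And>x. x \<noteq> 0 \<Longrightarrow> x \<bullet> (S ** (A + B ** F ** C) *v x) < 0"
  shows "\<exists>(G::real^'m^'m) (H::real^'p^'m).
    neg_def (block2 (msym (S ** (A + B ** (F ** C))))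
      (S ** B + transpose C ** transpose H - transpose (F ** C) ** transpose G)
      (transpose (S ** B + transpose C ** transpose H - transpose (F ** C) ** transpose G))
      (- G - transpose G)) \<and> F = matrix_inv G ** H"
proof -
  obtain g where "g > 0" and g: "\<And>x y. x \<noteq> 0 \<or> y \<noteq> 0 \<Longrightarrow>
      x \<bullet> (S ** (A + B ** F ** C) *v x) + x \<bullet> (S ** B *v y) - g * (y \<bullet> y) < 0"
    using large_scalar_block_exists [OF neg, of "S ** B"] by blast
  define G :: "real^'m^'m" where "G = g *\<^sub>R mat 1"
  have tG: "transpose G = G"
    by (simp add: G_def transpose_scalar)
  have GM: "G ** M = g *\<^sub>R M" "N ** G = g *\<^sub>R N" for M :: "real^'k^'m" and N :: "real^'m^'k"
    by (simp_all add: G_def matrix_eq mv_simps)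
  have "G ** (inverse g *\<^sub>R mat 1) = mat 1" "(inverse g *\<^sub>R mat 1) ** G = mat 1"
    using \<open>g > 0\<close> by (simp_all add: G_def matrix_eq mv_simps)
  then have "invertible G"
    unfolding invertible_def by blast
  then have F: "F = matrix_inv G ** (G ** F)"
    by (simp add: matrix_mul_assoc matrix_inv_left)
  have R: "S ** B + transpose C ** transpose (G ** F) - transpose (F ** C) ** transpose G = S ** B"
    by (simp add: matrix_transpose_mul tG GM transpose_scalar mult_scaleR_right matrix_mul_assoc)
  have "neg_def (block2 (msym (S ** (A + B ** (F ** C)))) (S ** B) (transpose (S ** B)) (- G - transpose G))"
    unfolding neg_def_block2_iff
  proof (intro conjI allI impI)
    show "transpose (- G - transpose G) = - G - transpose G"
      by (simp add: transpose_diff transpose_uminus)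
    fix x :: "real^'n" and y :: "real^'m"
    assume "x \<noteq> 0 \<or> y \<noteq> 0"
    have "y \<bullet> ((- G - G) *v y) = - 2 * g * (y \<bullet> y)"
      by (simp only: mv_simps G_def matrix_vector_mul_lid inner_diff_right inner_minus_right
          inner_scaleR_right)
    with g [OF \<open>x \<noteq> 0 \<or> y \<noteq> 0\<close>]
    show "x \<bullet> (msym (S ** (A + B ** (F ** C))) *v x) + 2 * (x \<bullet> (S ** B *v y)) + y \<bullet> ((- G - transpose G) *v y) < 0"
      unfolding inner_msym tG by (simp add: matrix_mul_assoc)
  qed (rule transpose_msym)
  then show ?thesis
    using F R by metis
qed

text \<open>The index type \<open>'k\<close> has n - r elements. Invertibility of
  \<open>X ** transpose E + E1 ** Y\<close> is stated so that the inverse in \<open>K0\<close> is a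
  genuine one; that of \<open>G\<close> follows from the block inequality.\<close>

theorem theorem3:
  fixes \<alpha> :: real
    and E A :: "real^'n^'n"
    and B :: "real^'m^'n"
    and C :: "real^'n^'p"
    and E1 :: "real^'k^'n"
    and E2 :: "real^'n^'k"
    and F :: "real^'p^'m"
  assumes "0 < \<alpha>" "\<alpha> < 1"
    and "rank E < CARD('n)"
    and "CARD('k) = CARD('n) - rank E"
    and "rank E1 = CARD('k)" "E ** E1 = 0"
    and "rank E2 = CARD('k)" "E2 ** E = 0"
  shows "admissible \<alpha> E (A + B ** F ** C) \<longleftrightarrow>
    (\<exists>(X::real^'n^'n) (Y::real^'n^'k) (Z::real^'n^'m).
       X \<in> P_alpha \<alpha> \<and>
       neg_def (msym (A ** X ** transpose E + A ** E1 ** Y + B ** Z)) \<and>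
       invertible (X ** transpose E + E1 ** Y) \<and>
       (let K0 = Z ** matrix_inv (X ** transpose E + E1 ** Y) in
        \<exists>(P::real^'n^'n) (Q::real^'k^'n) (G::real^'m^'m) (H::real^'p^'m).
          P \<in> P_alpha \<alpha> \<and>
          neg_def (block2
             (msym (transpose E ** P ** (A + B ** K0) + Q ** E2 ** (A + B ** K0)))
             ((transpose E ** P + Q ** E2) ** B + transpose C ** transpose H
                - transpose K0 ** transpose G)
             (transpose ((transpose E ** P + Q ** E2) ** B + transpose C ** transpose H
                - transpose K0 ** transpose G))
             (- G - transpose G)) \<and>
          F = matrix_inv G ** H))"
    (is "?adm \<longleftrightarrow> (\<exists>X Y Z. ?P X Y Z)")
proof
  define M where "M = A + B ** F ** C"
  assume adm: ?adm
  \<comment> \<open>The transposed closed-loop pencil is admissible too, with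
    \<open>transpose E1\<close> as left annihilator of \<open>transpose E\<close>. Transposing its
    inequality back yields \<open>X\<close> and \<open>Y\<close>.\<close>
  have "transpose E1 ** transpose E = 0"
    by (metis assms(6) matrix_transpose_mul times0_right transpose_mat mat_0)
  then have "\<exists>P\<in>P_alpha \<alpha>. \<exists>Q :: real^'k^'n. \<forall>x. x \<noteq> 0 \<longrightarrow>
      x \<bullet> ((transpose (transpose E) ** P ** transpose M + Q ** transpose E1 ** transpose M) *v x) < 0"
    using adm assms by (intro admissible_imp_lmi) (auto simp: admissible_transpose M_def rank_transpose)
  then obtain P' and Q' :: "real^'k^'n" where "P' \<in> P_alpha \<alpha>"
    and neg': "\<And>x. x \<noteq> 0 \<Longrightarrow> x \<bullet> ((E ** P' ** transpose M + Q' ** transpose E1 ** transpose M) *v x) < 0"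
    by auto
  define X where "X = transpose P'"
  define Y where "Y = transpose Q'"
  define W where "W = X ** transpose E + E1 ** Y"
  have X: "X \<in> P_alpha \<alpha>"
    unfolding X_def by (rule transpose_in_P_alpha) fact
  have "E ** P' ** transpose M + Q' ** transpose E1 ** transpose M = transpose (M ** W)"
    by (simp add: W_def X_def Y_def matrix_transpose_mul transpose_add matrix_mult_add_rdistrib matrix_mul_assoc)
  then have MW: "x \<bullet> (M ** W *v x) < 0" if "x \<noteq> 0" for x
    using neg' [OF that] by (simp add: inner_transpose_right)
  then have "invertible (M ** W)"
    by (rule neg_form_imp_invertible)
  then have W: "invertible W"
    by (metis invertible_left_inverse matrix_mul_assoc)
  \<comment> \<open>This choice makes \<open>K0\<close> equal to F C and turns the first inequality
    into the one for \<open>M ** W\<close> already obtained.\<close>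
  define Z where "Z = F ** C ** W"
  have AZ: "A ** X ** transpose E + A ** E1 ** Y + B ** Z = M ** W"
    by (simp add: Z_def M_def W_def matrix_mult_add_rdistrib matrix_add_ldistrib matrix_mul_assoc)
  have K0: "Z ** matrix_inv W = F ** C"
    by (simp add: Z_def matrix_inv_right W flip: matrix_mul_assoc)
  obtain P and Q :: "real^'k^'n" where P: "P \<in> P_alpha \<alpha>"
    and neg: "\<And>x. x \<noteq> 0 \<Longrightarrow> x \<bullet> ((transpose E ** P ** M + Q ** E2 ** M) *v x) < 0"
    using admissible_imp_lmi [OF assms(1,2,7,8,4) adm] unfolding M_def by blast
  have "x \<bullet> ((transpose E ** P + Q ** E2) ** (A + B ** F ** C) *v x) < 0" if "x \<noteq> 0" for x
    using neg [OF that] by (simp add: M_def matrix_mult_add_rdistrib)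
  from closed_loop_imp_block_lmi [OF this]
  obtain G :: "real^'m^'m" and H :: "real^'p^'m" where
    "neg_def (block2
             (msym ((transpose E ** P + Q ** E2) ** (A + B ** (F ** C))))
             ((transpose E ** P + Q ** E2) ** B + transpose C ** transpose H
                - transpose (F ** C) ** transpose G)
             (transpose ((transpose E ** P + Q ** E2) ** B + transpose C ** transpose H
                - transpose (F ** C) ** transpose G))
             (- G - transpose G))" "F = matrix_inv G ** H"
    by blast
  then have "?P X Y Z"
    unfolding Let_def W_def [symmetric] K0 AZ neg_def_msym_iff matrix_mult_add_rdistrib [symmetric]
    using X MW W P by blast
  then show "\<exists>X Y Z. ?P X Y Z"
    by blast
next
  assume "\<exists>X Y Z. ?P X Y Z"
  then obtain K0 :: "real^'n^'m" and P and Q :: "real^'k^'n" and G :: "real^'m^'m" and H :: "real^'p^'m"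
    where P: "P \<in> P_alpha \<alpha>" and F: "F = matrix_inv G ** H" and neg: "neg_def (block2
             (msym (transpose E ** P ** (A + B ** K0) + Q ** E2 ** (A + B ** K0)))
             ((transpose E ** P + Q ** E2) ** B + transpose C ** transpose H
                - transpose K0 ** transpose G)
             (transpose ((transpose E ** P + Q ** E2) ** B + transpose C ** transpose H
                - transpose K0 ** transpose G))
             (- G - transpose G))"
    unfolding Let_def by blast
  have "x \<bullet> ((transpose E ** P ** (A + B ** F ** C) + Q ** E2 ** (A + B ** F ** C)) *v x) < 0"
    if "x \<noteq> 0" for x
    \<comment> \<open>Both terms of the inequality have the left factor
      \<open>transpose E ** P + Q ** E2\<close>, which serves as \<open>S\<close> in the block
      lemma.\<close>
    using block_lmi_imp_closed_loop [OF neg [folded matrix_mult_add_rdistrib] that]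
    unfolding F matrix_mult_add_rdistrib .
  then show ?adm
    by (rule lmi_imp_admissible [OF assms(1,2,7,8,4) P])
qed

end
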